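(* $\mathfrak{p}=\mathfrak{t}$.
   Context: For $X,Y\subseteq\omega$, $X\subseteq_* Y$ means $X\setminus Y$ is finite. A family $\mathcal{B}$ of subsets of $\omega$ has the strong finite intersection property if every intersection of finitely many members of $\mathcal{B}$ is infinite; an infinite $X\subseteq\omega$ is a pseudo-intersection of $\mathcal{B}$ if $X\subseteq_* B$ for every $B\in\mathcal{B}$. $\mathfrak{p}$ is the least cardinality of a family of subsets of $\omega$ with the strong finite intersection property but with no pseudo-intersection. A tower is a sequence $(X_\alpha:\alpha<\kappa)$ of infinite subsets of $\omega$ with $X_\beta\subseteq_* X_\alpha$ whenever $\alpha<\beta<\kappa$; $\mathfrak{t}$ is the least cardinality of a tower with no pseudo-intersection. *)

theory Defs
  imports Main
begin

definition almost_subset :: "nat set \<Rightarrow> nat set \<Rightarrow> bool" (infix "\<subseteq>\<^sub>*" 50) where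
  "X \<subseteq>\<^sub>* Y \<longleftrightarrow> finite (X - Y)"

definition strong_fip :: "nat set set \<Rightarrow> bool" where
  "strong_fip B \<longleftrightarrow> (\<forall>C. finite C \<and> C \<subseteq> B \<longrightarrow> infinite (\<Inter>C))"

definition pseudo_intersection :: "nat set \<Rightarrow> nat set set \<Rightarrow> bool" where
  "pseudo_intersection X B \<longleftrightarrow> infinite X \<and> (\<forall>A\<in>B. X \<subseteq>\<^sub>* A)"

definition p_family :: "nat set set \<Rightarrow> bool" where
  "p_family B \<longleftrightarrow> strong_fip B \<and> \<not> (\<exists>X. pseudo_intersection X B)"

text \<open>A tower indexed by the ordinal given by the well-order r (on an index type of
  size continuum, which suffices since every tower has length below (2^aleph0)^+):
  infinite sets X \<alpha>, \<alpha> \<in> Field r, with X \<beta> \<subseteq>* X \<alpha> whenever \<alpha> < \<beta>.\<close>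
definition tower :: "nat set rel \<Rightarrow> (nat set \<Rightarrow> nat set) \<Rightarrow> bool" where
  "tower r X \<longleftrightarrow> Well_order r \<and> (\<forall>\<alpha>\<in>Field r. infinite (X \<alpha>)) \<and>
     (\<forall>\<alpha> \<beta>. (\<alpha>, \<beta>) \<in> r \<and> \<alpha> \<noteq> \<beta> \<longrightarrow> X \<beta> \<subseteq>\<^sub>* X \<alpha>)"

definition t_tower :: "nat set rel \<Rightarrow> (nat set \<Rightarrow> nat set) \<Rightarrow> bool" where
  "t_tower r X \<longleftrightarrow> tower r X \<and> \<not> (\<exists>Y. pseudo_intersection Y (X ` Field r))"

definition frak_p :: "nat set rel" where
  "frak_p = card_of (SOME B. p_family B \<and> (\<forall>B'. p_family B' \<longrightarrow> (card_of B, card_of B') \<in> ordLeq))"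

definition frak_t :: "nat set rel" where
  "frak_t = card_of (SOME K. (\<exists>r X. t_tower r X \<and> Field r = K) \<and>
      (\<forall>r' X'. t_tower r' X' \<longrightarrow> (card_of K, card_of (Field r')) \<in> ordLeq))"

end

(* A tower without pseudo-intersection is a family with the strong finite intersection property,
   so p <= t.  Conversely suppose B witnesses p and all towers of length at most |B| have
   pseudo-intersections.  Instead of forcing with infinite sets modulo finite, we work with functions
   on an infinite set A, compare them almost everywhere on A, and shrink A along well-ordered
   recursions.  Fewer than |B| conditions that are finitely satisfiable can be met simultaneously
   (saturation), and an almost increasing sequence of length at most |B| in a countable tree has an
   upper bound.

   The key step (after Malliaris and Shelah) is that a chain (d i : i < kappa) below a descending
   chain (e a : a < |B|), kappa < |B|, can be interpolated.  Otherwise climb a tree whose nodes carry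
   a descending bound and a finite set of names: the bound follows e, the names y a are chosen with
   G (y b) (y a) = d (h a b), where h a is an injection into kappa of the predecessors of a (if a
   has at most kappa many), and G of two names in the set never exceeds the bound.  Past the end of
   the climb each name survives until the bound has dropped below some d i, as otherwise the bound
   at its last occurrence would interpolate.  Among more than kappa names, some y a and kappa many earlier y b share the same i,
   so h a maps kappa many b injectively below i, which is impossible.

   Finally climb a tree of shrinking finite sets, all meeting every finite intersection from B,
   intersecting with one more member of B at each step; interpolation supplies the index at which
   the upper bound of the previous stages still meets all these intersections. *)

theory Submission
  imports Defs "HOL-Library.Countable" "HOL-Library.Infinite_Set" "HOL-Library.Sublist"
begin

unbundle cardinal_syntax

subsection \<open>Almost inclusion and well-orders\<close>

text \<open>"For almost all \<open>n\<close> in \<open>A\<close>" as a filter, so that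
  \<open>eventually_elim\<close> combines finitely many such facts, and replacing \<open>A\<close>
  by an almost subset only refines the filter.\<close>

definition tail :: "nat set \<Rightarrow> nat filter" where
  "tail A = inf cofinite (principal A)"

lemma eventually_tail: "eventually P (tail A) \<longleftrightarrow> finite {n \<in> A. \<not> P n}"
  by (simp add: tail_def eventually_inf_principal eventually_cofinite Collect_conj_eq)

lemma tail_le_iff: "tail A \<le> tail C \<longleftrightarrow> A \<subseteq>\<^sub>* C"
proof
  assume "tail A \<le> tail C"
  moreover have "eventually (\<lambda>n. n \<in> C) (tail C)"
    by (simp add: eventually_tail)
  ultimately have "eventually (\<lambda>n. n \<in> C) (tail A)"
    by (rule filter_leD)
  moreover have "{n \<in> A. n \<notin> C} = A - C" by auto
  ultimately show "A \<subseteq>\<^sub>* C"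
    by (simp add: eventually_tail almost_subset_def)
next
  assume *: "A \<subseteq>\<^sub>* C"
  show "tail A \<le> tail C"
  proof (rule filter_leI)
    fix P assume "eventually P (tail C)"
    then have "finite ({n \<in> C. \<not> P n} \<union> (A - C))"
      using * by (simp add: eventually_tail almost_subset_def)
    then show "eventually P (tail A)"
      unfolding eventually_tail by (rule rev_finite_subset) auto
  qed
qed

lemma eventually_tailI: "(\<And>n. n \<in> A \<Longrightarrow> P n) \<Longrightarrow> eventually P (tail A)"
  by (simp add: tail_def eventually_inf_principal)

lemma eventually_tail_mono: "eventually P (tail C) \<Longrightarrow> A \<subseteq>\<^sub>* C \<Longrightarrow> eventually P (tail A)"
  using filter_leD tail_le_iff by blast

lemma almost_subset_trans: "X \<subseteq>\<^sub>* Y \<Longrightarrow> Y \<subseteq>\<^sub>* Z \<Longrightarrow> X \<subseteq>\<^sub>* Z"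
  by (metis tail_le_iff order_trans)

lemma subset_imp_almost_subset: "X \<subseteq> Y \<Longrightarrow> X \<subseteq>\<^sub>* Y"
  by (metis Diff_eq_empty_iff almost_subset_def finite.emptyI)

lemma eventually_tail_in: "A \<subseteq>\<^sub>* C \<Longrightarrow> eventually (\<lambda>n. n \<in> C) (tail A)"
  by (rule eventually_tail_mono[of _ C]) (simp_all add: eventually_tail)

lemma eventually_tail_infinite:
  assumes "eventually P (tail A)" "infinite A"
  shows "infinite {n \<in> A. P n}"
proof
  assume "finite {n \<in> A. P n}"
  then have "finite ({n \<in> A. P n} \<union> {n \<in> A. \<not> P n})"
    using assms(1) by (simp add: eventually_tail)
  then have "finite A" by (rule rev_finite_subset) auto
  with assms(2) show False by simp
qed

lemma infinite_almost_subset: "infinite X \<Longrightarrow> X \<subseteq>\<^sub>* Y \<Longrightarrow> infinite (X \<inter> Y)"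
  using eventually_tail_infinite[OF eventually_tail_in, of X Y] by (simp add: Collect_conj_eq)

lemma finite_Inter_almost_subset:
  assumes "finite C" "\<And>Z. Z \<in> C \<Longrightarrow> X \<subseteq>\<^sub>* Z"
  shows "X \<subseteq>\<^sub>* \<Inter>C"
proof -
  have *: "X - \<Inter>C = (\<Union>Z\<in>C. X - Z)" by auto
  show ?thesis unfolding almost_subset_def *
    using assms by (intro finite_UN_I) (auto simp: almost_subset_def)
qed

section \<open>Recursion along well-orders\<close>

text \<open>Dependent choice of transfinite length: \<open>I\<close> is what stage \<open>a\<close>
  must satisfy alone, \<open>R\<close> how it must fit each earlier stage. In every use
  \<open>R\<close> includes almost inclusion of the infinite sets attached to the stages.\<close>

lemma well_order_construct:
  assumes wo: "Well_order r"
    and step: "\<And>a f. a \<in> Field r \<Longrightarrow> (\<forall>b\<in>underS r a. I b (f b)) \<Longrightarrow>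
      (\<forall>b\<in>underS r a. \<forall>c\<in>underS r b. R c b (f c) (f b)) \<Longrightarrow>
      \<exists>x. I a x \<and> (\<forall>b\<in>underS r a. R b a (f b) x)"
  obtains f where "\<And>a. a \<in> Field r \<Longrightarrow> I a (f a)"
    and "\<And>a b. a \<in> Field r \<Longrightarrow> b \<in> underS r a \<Longrightarrow> R b a (f b) (f a)"
proof -
  \<comment> \<open>\<open>H\<close> consults \<open>g\<close> only at predecessors of
    \<open>a\<close>, so the \<open>cut\<close> introduced by \<open>wfrec\<close> changes
    nothing.\<close>
  define H where "H = (\<lambda>g a. SOME x. I a x \<and> (\<forall>b\<in>underS r a. R b a (g b) x))"
  define f where "f = wfrec (r - Id) H"
  have wf: "wf (r - Id)" using wo by (simp add: well_order_on_def)
  have rel: "b \<in> underS r a \<longleftrightarrow> (b, a) \<in> r - Id" for a b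
    by (auto simp: underS_def)
  have f: "f a = (SOME x. I a x \<and> (\<forall>b\<in>underS r a. R b a (f b) x))" for a
  proof -
    have "f a = H (cut f (r - Id) a) a"
      unfolding f_def by (rule wfrec[OF wf])
    also have "\<dots> = (SOME x. I a x \<and> (\<forall>b\<in>underS r a. R b a (f b) x))"
    proof -
      have "(\<forall>b\<in>underS r a. R b a (cut f (r - Id) a b) x) \<longleftrightarrow> (\<forall>b\<in>underS r a. R b a (f b) x)" for x
        by (intro ball_cong refl) (simp only: rel cut_apply)
      then show ?thesis unfolding H_def by simp
    qed
    finally show ?thesis .
  qed
  have "a \<in> Field r \<longrightarrow> I a (f a) \<and> (\<forall>b\<in>underS r a. R b a (f b) (f a))" for a
  proof (induction a rule: wf_induct_rule[OF wf])
    case (1 a)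
    show ?case
    proof
      assume a: "a \<in> Field r"
      have "b \<in> Field r" if "b \<in> underS r a" for b
        using that by (auto simp: underS_def Field_def)
      with 1 have "\<forall>b\<in>underS r a. I b (f b)"
        "\<forall>b\<in>underS r a. \<forall>c\<in>underS r b. R c b (f c) (f b)"
        by (auto simp: rel)
      from someI_ex[OF step[OF a this]] show "I a (f a) \<and> (\<forall>b\<in>underS r a. R b a (f b) (f a))"
        unfolding f[of a, symmetric] .
    qed
  qed
  then show ?thesis using that by blast
qed

lemma wo_trichotomy:
  assumes "Well_order r" "a \<in> Field r" "b \<in> Field r"
  obtains "a = b" | "a \<in> underS r b" | "b \<in> underS r a"
  using assms by (auto simp: underS_def well_order_on_def linear_order_on_def total_on_def)

lemma underS_trans:
  assumes "Well_order r" "c \<in> underS r b" "b \<in> underS r a"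
  shows "c \<in> underS r a"
proof -
  have "trans r" "antisym r"
    using assms(1) by (auto simp: order_on_defs)
  then show ?thesis using assms(2,3) by (auto simp: underS_def dest: transD antisymD)
qed

lemma mem_underS_Field: "b \<in> underS r a \<Longrightarrow> b \<in> Field r"
  by (auto simp: underS_def Field_def)

lemma wo_finite_max:
  assumes wo: "Well_order r" and "finite F" "F \<noteq> {}" "F \<subseteq> Field r"
  obtains m where "m \<in> F" "\<And>b. b \<in> F \<Longrightarrow> b = m \<or> b \<in> underS r m"
proof -
  have "\<exists>m\<in>F. \<forall>b\<in>F. b = m \<or> b \<in> underS r m"
    using assms(2-4)
  proof (induction F rule: finite_ne_induct)
    case (singleton x)
    then show ?case by simp
  next
    case (insert x F)
    then obtain m where m: "m \<in> F" "\<forall>b\<in>F. b = m \<or> b \<in> underS r m" by auto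
    have "x \<in> Field r" "m \<in> Field r" using insert m by auto
    with wo consider "x = m \<or> x \<in> underS r m" | "m \<in> underS r x"
      using wo_trichotomy by metis
    then show ?case
    proof cases
      case 1
      then show ?thesis using m by auto
    next
      case 2
      then have "\<forall>b\<in>F. b \<in> underS r x" using m(2) underS_trans[OF wo] by metis
      then show ?thesis by auto
    qed
  qed
  then show ?thesis using that by blast
qed

text \<open>Of finitely many members the latest is almost contained in all of them, hence in their
  intersection. This is the source of p \<le> t.\<close>

lemma tower_strong_fip:
  assumes "tower r X"
  shows "strong_fip (X ` Field r)"
  unfolding strong_fip_def
proof (intro allI impI)
  fix C assume C: "finite C \<and> C \<subseteq> X ` Field r"
  then obtain F where F: "F \<subseteq> Field r" "finite F" "C = X ` F"
    by (meson finite_subset_image)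
  have wo: "Well_order r" using assms by (simp add: tower_def)
  show "infinite (\<Inter>C)"
  proof (cases "F = {}")
    case True
    then show ?thesis using F by simp
  next
    case False
    then obtain m where m: "m \<in> F" "\<And>b. b \<in> F \<Longrightarrow> b = m \<or> b \<in> underS r m"
      using wo_finite_max[OF wo F(2) _ F(1)] by blast
    have "X m \<subseteq>\<^sub>* Z" if "Z \<in> C" for Z
    proof -
      obtain b where "b \<in> F" "Z = X b" using \<open>Z \<in> C\<close> F(3) by blast
      with m(2)[of b] assms show ?thesis
        by (auto simp: tower_def underS_def subset_imp_almost_subset)
    qed
    then have "X m \<subseteq>\<^sub>* \<Inter>C" using C by (intro finite_Inter_almost_subset) auto
    moreover have "infinite (X m)" using assms m(1) F(1) by (auto simp: tower_def)
    ultimately show ?thesis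
      by (meson infinite_almost_subset finite_Int)
  qed
qed

section \<open>Coding functions on an infinite set by sets of numbers\<close>

text \<open>A region of the plane over the columns \<open>n \<in> A\<close>, coded as a set of
  numbers, so that a pseudo-intersection of regions yields a function lying in each of them almost
  everywhere.\<close>

definition encode :: "nat set \<Rightarrow> (nat \<Rightarrow> 'b::countable \<Rightarrow> bool) \<Rightarrow> nat set" where
  "encode A P = {prod_encode (n, to_nat x) | n x. n \<in> A \<and> P n x}"

lemma prod_encode_mem_encode [simp]:
  "prod_encode (n, to_nat x) \<in> encode A P \<longleftrightarrow> n \<in> A \<and> P n x"
  by (auto simp: encode_def)

lemma infinite_encode:
  assumes "infinite A" "eventually (\<lambda>n. \<exists>x. P n x) (tail A)"
  shows "infinite (encode A P)"
proof -
  let ?D = "{n \<in> A. \<exists>x. P n x}"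
  let ?f = "\<lambda>n. prod_encode (n, to_nat (SOME x. P n x))"
  have "infinite ?D" using assms by (rule eventually_tail_infinite[rotated])
  moreover have "inj_on ?f ?D" by (auto simp: inj_on_def)
  moreover have "?f ` ?D \<subseteq> encode A P" by (auto intro: someI)
  ultimately show ?thesis by (meson finite_imageD finite_subset)
qed

text \<open>Finite columns force the infinite \<open>Y\<close> to occupy infinitely many of them,
  and \<open>c\<close> picks one point of \<open>Y\<close> in each. It leaves a region only in the
  columns of the finitely many points of \<open>Y\<close> outside that region.\<close>

lemma selector_of_encode:
  fixes P0 :: "nat \<Rightarrow> 'b::countable \<Rightarrow> bool"
  assumes Y: "infinite Y" "Y \<subseteq> encode A0 P0"
    and col: "\<And>n. finite {y \<in> Y. fst (prod_decode y) = n}"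
  obtains A' and c :: "nat \<Rightarrow> 'b" where "infinite A'" "A' \<subseteq> A0"
    "\<And>P. Y \<subseteq>\<^sub>* encode A0 P \<Longrightarrow> eventually (\<lambda>n. P n (c n)) (tail A')"
proof -
  define A' where "A' = (\<lambda>y. fst (prod_decode y)) ` Y"
  define c where "c = (\<lambda>n. SOME x::'b. prod_encode (n, to_nat x) \<in> Y)"
  have c: "prod_encode (n, to_nat (c n)) \<in> Y" if n: "n \<in> A'" for n
  proof -
    obtain y where y: "y \<in> Y" "n = fst (prod_decode y)" using n by (auto simp: A'_def)
    then obtain m and x :: 'b where "y = prod_encode (m, to_nat x)"
      using Y(2) by (auto simp: encode_def)
    with y have "\<exists>x::'b. prod_encode (n, to_nat x) \<in> Y" by auto
    then show ?thesis unfolding c_def by (rule someI_ex)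
  qed
  have "infinite A'"
  proof
    assume "finite A'"
    then have "finite (\<Union>n\<in>A'. {y \<in> Y. fst (prod_decode y) = n})" using col by blast
    moreover have "Y \<subseteq> (\<Union>n\<in>A'. {y \<in> Y. fst (prod_decode y) = n})" by (auto simp: A'_def)
    ultimately show False using Y(1) finite_subset by blast
  qed
  moreover have "A' \<subseteq> A0" using Y(2) by (auto simp: A'_def encode_def)
  moreover have "eventually (\<lambda>n. P n (c n)) (tail A')" if P: "Y \<subseteq>\<^sub>* encode A0 P" for P
  proof -
    have "finite ((\<lambda>y. fst (prod_decode y)) ` (Y - encode A0 P))"
      using P by (simp add: almost_subset_def)
    moreover have "{n \<in> A'. \<not> P n (c n)} \<subseteq> (\<lambda>y. fst (prod_decode y)) ` (Y - encode A0 P)"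
    proof
      fix n assume "n \<in> {n \<in> A'. \<not> P n (c n)}"
      then have "prod_encode (n, to_nat (c n)) \<in> Y - encode A0 P" using c by auto
      then show "n \<in> (\<lambda>y. fst (prod_decode y)) ` (Y - encode A0 P)" by (force intro: image_eqI)
    qed
    ultimately show ?thesis unfolding eventually_tail by (rule rev_finite_subset)
  qed
  ultimately show ?thesis using that by blast
qed

text \<open>Greedy choice: each element exceeds both the previous one and its
  \<open>h\<close>-value. Monotonicity of \<open>h\<close> passes from neighbours to arbitrary
  pairs.\<close>

lemma infinite_sparse_subset:
  fixes h :: "nat \<Rightarrow> nat"
  assumes "infinite A" "mono h"
  obtains X where "infinite X" "X \<subseteq> A" "\<And>x y. x \<in> X \<Longrightarrow> y \<in> X \<Longrightarrow> x < y \<Longrightarrow> h x < y"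
proof -
  have "\<exists>s. \<forall>n. s n \<in> A \<and> (s n < s (Suc n) \<and> h (s n) < s (Suc n))"
  proof (rule dependent_nat_choice)
    show "\<exists>x. x \<in> A" using assms(1) by (metis finite.emptyI ex_in_conv)
    fix x
    obtain y where "y \<in> A" "max x (h x) < y"
      using assms(1) by (meson infinite_nat_iff_unbounded)
    then show "\<exists>y. y \<in> A \<and> x < y \<and> h x < y" by auto
  qed
  then obtain s where s: "\<And>n. s n \<in> A" "\<And>n. s n < s (Suc n)" "\<And>n. h (s n) < s (Suc n)"
    by blast
  have sm: "strict_mono s" using s(2) by (rule strict_mono_Suc_iff[THEN iffD2, rule_format])
  have "h (s m) < s k" if "s m < s k" for m k
  proof -
    have "m < k" using that sm strict_mono_less by blast
    then have "s m \<le> s (k - 1)" "Suc (k - 1) = k" using sm by (auto simp: strict_mono_less_eq)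
    then show ?thesis using s(3)[of "k - 1"] assms(2) by (metis le_less_trans monoD)
  qed
  moreover have "infinite (range s)" using sm by (intro range_inj_infinite strict_mono_imp_inj_on)
  ultimately show ?thesis
    using that[of "range s"] s(1) by blast
qed

lemma card_of_underS_ordLeq: "|Field r| \<le>o k \<Longrightarrow> |underS r a| \<le>o k"
  by (meson card_of_mono1 mem_underS_Field ordLeq_transitive subsetI)

subsection \<open>Trees of finite approximations\<close>

text \<open>Let \<open>y\<close> code a finite list and \<open>G x y\<close> be its entry at
  \<open>x\<close>. Then a single \<open>y\<close> prescribes the values at all arguments up to
  \<open>k\<close>.\<close>

lemma function_decoder:
  obtains G :: "nat \<Rightarrow> nat \<Rightarrow> nat" where "\<And>F k. \<exists>y>k. \<forall>x\<le>k. G x y = F x"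
proof -
  define G where "G = (\<lambda>x y. list_decode (snd (prod_decode y)) ! x)"
  have "\<exists>y>k. \<forall>x\<le>k. G x y = F x" for F k
  proof (intro exI conjI allI impI)
    \<comment> \<open>The first component \<open>Suc k\<close> pushes the code above
      \<open>k\<close>; \<open>G\<close> reads the second component only.\<close>
    let ?y = "prod_encode (Suc k, list_encode (map F [0..<Suc k]))"
    show "k < ?y" using le_prod_encode_1[of "Suc k"] by (simp add: Suc_le_eq)
    show "G x ?y = F x" if "x \<le> k" for x
      using that by (simp add: G_def del: upt_Suc)
  qed
  then show ?thesis by (rule that)
qed

lemma not_eventually_tail:
  assumes "\<not> eventually P (tail A)"
  obtains A' where "infinite A'" "A' \<subseteq> A" "\<And>n. n \<in> A' \<Longrightarrow> \<not> P n"
proof (rule that[of "{n \<in> A. \<not> P n}"])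
  show "infinite {n \<in> A. \<not> P n}" using assms by (simp add: eventually_tail)
qed auto

text \<open>A node is a list of pairs \<open>(a, D)\<close>: the bounds \<open>a\<close> descend, and \<open>G\<close> of a pair taken from the
  finite set \<open>D\<close> stays below the current bound.\<close>
definition node :: "(nat \<Rightarrow> nat \<Rightarrow> nat) \<Rightarrow> (nat \<times> nat list) list \<Rightarrow> bool" where
  "node G s \<longleftrightarrow> sorted_wrt (\<lambda>p q. fst q \<le> fst p) s \<and>
     (\<forall>(a, D)\<in>set s. \<forall>x\<in>set D. \<forall>y\<in>set D. x < y \<longrightarrow> G x y \<le> a)"

lemma node_antimono:
  assumes "node G s" "i \<le> j" "j < length s"
  shows "fst (s ! j) \<le> fst (s ! i)"
  using assms by (cases "i = j") (auto simp: node_def sorted_wrt_iff_nth_less)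

lemma nodeD:
  assumes "node G s" "j < length s" "x \<in> set (snd (s ! j))" "y \<in> set (snd (s ! j))" "x < y"
  shows "G x y \<le> fst (s ! j)"
proof -
  have "s ! j \<in> set s" using assms(2) by simp
  with assms show ?thesis by (auto simp: node_def case_prod_beta)
qed

lemma node_snoc:
  assumes "node G s" "s = [] \<or> a \<le> fst (last s)"
    "\<And>x y. x \<in> set D \<Longrightarrow> y \<in> set D \<Longrightarrow> x < y \<Longrightarrow> G x y \<le> a"
  shows "node G (s @ [(a, D)])"
proof -
  have "a \<le> fst p" if "p \<in> set s" for p
  proof -
    obtain i where i: "i < length s" "p = s ! i" using \<open>p \<in> set s\<close> by (metis in_set_conv_nth)
    have "s \<noteq> []" using i by auto
    then have "fst (last s) \<le> fst (s ! i)"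
      using node_antimono[OF assms(1), of i "length s - 1"] i by (simp add: last_conv_nth)
    then show ?thesis using assms(2) \<open>s \<noteq> []\<close> i(2) by auto
  qed
  then show ?thesis using assms(1,3) by (auto simp: node_def sorted_wrt_append)
qed

lemma prefix_take: "prefix xs ys \<Longrightarrow> length xs \<le> k \<Longrightarrow> prefix xs (take k ys)"
  by (auto simp: prefix_def)

text \<open>A node of the final climb: decreasing finite sets, written as lists. Nonemptiness gives
  the node a last set.\<close>

definition shrinking :: "nat list list \<Rightarrow> bool" where
  "shrinking s \<longleftrightarrow> s \<noteq> [] \<and> sorted_wrt (\<lambda>p q. set q \<subseteq> set p) s"

lemma shrinking_antimono:
  assumes "shrinking s" "i \<le> j" "j < length s"
  shows "set (s ! j) \<subseteq> set (s ! i)"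
  using assms by (cases "i = j") (auto simp: shrinking_def sorted_wrt_iff_nth_less)

text \<open>The node is cut at \<open>j\<close> before the new set is appended because the later
  sets of an upper bound may already be too small to be useful.\<close>

lemma shrinking_snoc:
  assumes s: "shrinking s" and j: "j < length s" and D: "set D \<subseteq> set (s ! j)"
  shows "shrinking (take (Suc j) s @ [D])"
proof -
  have "set D \<subseteq> set p" if p: "p \<in> set (take (Suc j) s)" for p
  proof -
    obtain i where "i < length (take (Suc j) s)" "p = take (Suc j) s ! i"
      using p by (metis in_set_conv_nth)
    then have "i \<le> j" "p = s ! i" by auto
    then show ?thesis using shrinking_antimono[OF s _ j] D by blast
  qed
  then show ?thesis using s by (auto simp: shrinking_def sorted_wrt_append sorted_wrt_take)
qed

lemma prefix_last_nth:
  assumes "prefix s t" "s \<noteq> []"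
  shows "length s - 1 < length t" "last s = t ! (length s - 1)"
proof -
  obtain u where u: "t = s @ u" using assms(1) by (auto simp: prefix_def)
  have "length s > 0" using assms(2) by simp
  then show "length s - 1 < length t" "last s = t ! (length s - 1)"
    using assms(2) unfolding u by (auto simp: last_conv_nth nth_append trans_less_add1)
qed

subsection \<open>Cardinal arithmetic\<close>

text \<open>If \<open>W\<close> were larger than \<open>A\<close>, the cardinal of \<open>A\<close>
  would be isomorphic to a proper initial segment of \<open>W\<close> under \<open>r\<close>, which
  \<open>seg\<close> forbids.\<close>

lemma card_le_of_initial_segments:
  assumes wo: "Well_order r" and W: "W \<subseteq> Field r"
    and seg: "\<And>b. b \<in> W \<Longrightarrow> \<not> |A| \<le>o |{c \<in> W. c \<in> underS r b}|"
  shows "|W| \<le>o |A|"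
proof (rule ccontr)
  assume "\<not> |W| \<le>o |A|"
  then have "|A| <o |W|"
    by (rule not_ordLeq_iff_ordLess[OF card_of_Well_order card_of_Well_order, THEN iffD1])
  moreover have FW: "Field (Restr r W) = W"
    using wo W by (intro Refl_Field_Restr2) (auto simp: order_on_defs)
  have wo': "Well_order (Restr r W)" using wo by (rule Well_order_Restr)
  then have "|W| \<le>o Restr r W" using FW card_of_least by metis
  ultimately have "|A| <o Restr r W" by (rule ordLess_ordLeq_trans)
  then obtain b where b: "b \<in> W" "|A| =o Restr (Restr r W) (underS (Restr r W) b)"
    using ordLess_iff_ordIso_Restr[OF wo' card_of_Well_order] FW by auto
  have "|Field (card_of A)| =o |Field (Restr (Restr r W) (underS (Restr r W) b))|"
    using b(2) by (rule card_of_cong)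
  moreover have "|Field (Restr (Restr r W) (underS (Restr r W) b))| \<le>o |{c \<in> W. c \<in> underS r b}|"
    by (intro card_of_mono1) (auto simp: Field_def underS_def)
  ultimately have "|A| \<le>o |{c \<in> W. c \<in> underS r b}|"
    by (simp add: Field_card_of ordIso_ordLeq_trans)
  with seg[OF b(1)] show False by blast
qed

text \<open>More than \<open>|A|\<close> indices have at most \<open>|A|\<close> predecessors, and
  \<open>k\<close> splits them into at most \<open>|A|\<close> classes. If each of them had fewer
  than \<open>|A|\<close> predecessors of its own class, every class would have size at most
  \<open>|A|\<close>, and so would their union.\<close>

lemma pigeonhole_initial_segment:
  fixes k :: "'i \<Rightarrow> 'k"
  assumes wo: "Well_order r" and inf: "infinite A" and less: "|A| <o |Field r|" and k: "k ` Field r \<subseteq> A"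
  obtains b where "b \<in> Field r" "|underS r b| \<le>o |A|" "|A| \<le>o |{c \<in> underS r b. k c = k b}|"
proof -
  note found = that
  define K where "K = {b \<in> Field r. |underS r b| \<le>o |A|}"
  have K: "\<not> |K| \<le>o |A|"
  proof
    assume le: "|K| \<le>o |A|"
    show False
    proof (cases "K = Field r")
      case True
      then show ?thesis using le less not_ordLess_ordLeq by blast
    next
      case False
      \<comment> \<open>The least index outside \<open>K\<close> has all its predecessors in
        \<open>K\<close>, so a small \<open>K\<close> would have to contain it.\<close>
      then obtain a where a: "a \<in> Field r - K" "\<And>b. (b, a) \<in> r - Id \<Longrightarrow> b \<notin> Field r - K"
        using wfE_min[of "r - Id" _ "Field r - K"] wo by (auto simp: K_def well_order_on_def)
      have "underS r a \<subseteq> K"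
      proof
        fix b assume "b \<in> underS r a"
        then show "b \<in> K" using a(2)[of b] mem_underS_Field[of b r a] by (auto simp: underS_def)
      qed
      then have "|underS r a| \<le>o |A|" using le card_of_mono1 ordLeq_transitive by blast
      then show False using a(1) by (auto simp: K_def)
    qed
  qed
  show ?thesis
  proof (rule ccontr)
    assume not: "\<not> thesis"
    have no: "\<not> |A| \<le>o |{c \<in> underS r b. k c = k b}|" if "b \<in> K" for b
      using not found[of b] \<open>b \<in> K\<close> by (auto simp: K_def)
    define W where "W = (\<lambda>i. {b \<in> K. k b = i})"
    have "|W i| \<le>o |A|" for i
    proof (rule card_le_of_initial_segments[OF wo])
      show "W i \<subseteq> Field r" by (auto simp: W_def K_def)
      fix b assume b: "b \<in> W i"
      have "{c \<in> W i. c \<in> underS r b} \<subseteq> {c \<in> underS r b. k c = k b}"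
        using b by (auto simp: W_def)
      then have "|{c \<in> W i. c \<in> underS r b}| \<le>o |{c \<in> underS r b. k c = k b}|"
        by (rule card_of_mono1)
      then show "\<not> |A| \<le>o |{c \<in> W i. c \<in> underS r b}|"
        using no[of b] b ordLeq_transitive unfolding W_def by blast
    qed
    then have "|\<Union>i\<in>A. W i| \<le>o |A|"
      using inf by (intro card_of_UNION_ordLeq_infinite ballI) (auto simp: card_of_refl ordIso_imp_ordLeq)
    moreover have "K = (\<Union>i\<in>A. W i)" using k by (auto simp: W_def K_def)
    ultimately show False using K by simp
  qed
qed

lemma card_of_insert_ordLess:
  assumes "infinite Y" "|X| <o |Y|"
  shows "|insert x X| <o |Y|"
proof -
  have "|{x}| <o |Y|"
    using assms(1) by (simp add: finite_ordLess_infinite[OF card_of_Well_order card_of_Well_order] Field_card_of)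
  then have "|{x} \<union> X| <o |Y|" using assms by (intro card_of_Un_ordLess_infinite)
  then show ?thesis by simp
qed

text \<open>By induction on \<open>n\<close>, the subsets of size \<open>n\<close> are at most
  \<open>|X|\<close> many: a set of size \<open>n + 1\<close> comes from a pair of an element and a
  set of size \<open>n\<close>.\<close>

lemma card_of_Fpow_infinite:
  assumes "infinite X"
  shows "|Fpow X| \<le>o |X|"
proof -
  let ?F = "\<lambda>n. {F \<in> Fpow X. card F = n}"
  have "|?F n| \<le>o |X|" for n
  proof (induction n)
    case 0
    have "?F 0 \<subseteq> {{}}" by (auto simp: Fpow_def)
    then have "finite (?F 0)" by (rule finite_subset) simp
    then show ?case using assms
      by (intro ordLess_imp_ordLeq finite_ordLess_infinite card_of_Well_order) (simp_all add: Field_card_of)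
  next
    case (Suc n)
    have "?F (Suc n) \<subseteq> (\<lambda>(x, F). insert x F) ` (X \<times> ?F n)"
    proof
      fix F assume F: "F \<in> ?F (Suc n)"
      then obtain x where x: "x \<in> F" by fastforce
      then have "F = insert x (F - {x})" "x \<in> X" "F - {x} \<in> ?F n"
        using F by (auto simp: Fpow_def card_Diff_singleton)
      then show "F \<in> (\<lambda>(x, F). insert x F) ` (X \<times> ?F n)" by (intro image_eqI[of _ _ "(x, F - {x})"]) auto
    qed
    then have "|?F (Suc n)| \<le>o |(\<lambda>(x, F). insert x F) ` (X \<times> ?F n)|" by (rule card_of_mono1)
    also have "|(\<lambda>(x, F). insert x F) ` (X \<times> ?F n)| \<le>o |X \<times> ?F n|" by (rule card_of_image)
    also have "|X \<times> ?F n| \<le>o |X|"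
      using card_of_Times_mono2[OF Suc.IH] card_of_Times_same_infinite[OF assms]
      by (rule ordLeq_ordIso_trans)
    finally show ?case .
  qed
  then have "|\<Union>n\<in>UNIV. ?F n| \<le>o |X|"
    using assms infinite_iff_card_of_nat by (intro card_of_UNION_ordLeq_infinite) auto
  moreover have "Fpow X = (\<Union>n\<in>UNIV. ?F n)" by auto
  ultimately show ?thesis by simp
qed

subsection \<open>Consequences of p < t\<close>

text \<open>The situation to be refuted for a family \<open>B\<close> of size p: the first clause is
  the minimality of \<open>|B|\<close>, the second says that no tower of length at most
  \<open>|B|\<close> witnesses t.\<close>

locale p_less_t =
  fixes B :: "nat set set"
  assumes small_sfip: "\<And>C. |C| <o |B| \<Longrightarrow> strong_fip C \<Longrightarrow> \<exists>X. pseudo_intersection X C"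
    and short_towers: "\<And>r X. tower r X \<Longrightarrow> |Field r| \<le>o |B| \<Longrightarrow> \<exists>Y. pseudo_intersection Y (X ` Field r)"
begin

section \<open>Lower bounds of towers and dominating functions\<close>

text \<open>An injection of \<open>J\<close> into \<open>B\<close> moves the indices to the type
  that \<open>tower\<close> demands, so recursions may run over stages of any type. Intersecting
  with \<open>A0\<close> at the end turns almost inclusion into inclusion.\<close>

lemma tower_lower_bound:
  fixes r :: "'i rel" and A :: "'i \<Rightarrow> nat set"
  assumes wo: "Well_order r" and J: "J \<subseteq> Field r" "|J| \<le>o |B|" and A0: "infinite A0"
    and A: "\<And>a. a \<in> J \<Longrightarrow> infinite (A a)" "\<And>a. a \<in> J \<Longrightarrow> A a \<subseteq> A0"
    and dec: "\<And>a b. a \<in> J \<Longrightarrow> b \<in> J \<Longrightarrow> b \<in> underS r a \<Longrightarrow> A a \<subseteq>\<^sub>* A b"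
  obtains A' where "infinite A'" "A' \<subseteq> A0" "\<And>a. a \<in> J \<Longrightarrow> A' \<subseteq>\<^sub>* A a"
proof (cases "J = {}")
  case True
  with A0 that show ?thesis by blast
next
  case False
  obtain f where f: "inj_on f J" "f ` J \<subseteq> B"
    using J(2) card_of_ordLeq[of J B] by auto
  let ?r = "Restr r J"
  have FJ: "Field ?r = J"
    using wo J(1) by (intro Refl_Field_Restr2) (auto simp: order_on_defs)
  define r' where "r' = dir_image ?r f"
  define X where "X = A \<circ> inv_into J f"
  have Xf: "X (f a) = A a" if "a \<in> J" for a
    using that f(1) by (simp add: X_def)
  have F': "Field r' = f ` J" unfolding r'_def dir_image_Field FJ ..
  have wo': "Well_order r'" unfolding r'_def
    using wo f(1) FJ by (intro Well_order_dir_image Well_order_Restr) auto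
  have "X \<beta> \<subseteq>\<^sub>* X \<alpha>" if "(\<alpha>, \<beta>) \<in> r'" "\<alpha> \<noteq> \<beta>" for \<alpha> \<beta>
  proof -
    obtain a b where ab: "a \<in> J" "b \<in> J" "(a, b) \<in> r" "\<alpha> = f a" "\<beta> = f b"
      using \<open>(\<alpha>, \<beta>) \<in> r'\<close> unfolding r'_def dir_image_def by blast
    then show ?thesis using \<open>\<alpha> \<noteq> \<beta>\<close> dec[of b a] by (auto simp: Xf underS_def)
  qed
  then have "tower r' X"
    using wo' A(1) by (auto simp: tower_def F' Xf)
  moreover have "|Field r'| \<le>o |B|" unfolding F' using f(2) by (rule card_of_mono1)
  ultimately obtain Y where "pseudo_intersection Y (X ` Field r')"
    using short_towers by blast
  then have Y: "infinite Y" "\<And>a. a \<in> J \<Longrightarrow> Y \<subseteq>\<^sub>* A a"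
    by (auto simp: pseudo_intersection_def F' Xf)
  obtain j where "j \<in> J" using False by blast
  then have "Y \<subseteq>\<^sub>* A0"
    using Y(2) A(2) almost_subset_trans subset_imp_almost_subset by metis
  then show ?thesis
    using Y infinite_almost_subset[of Y A0]
      almost_subset_trans[OF subset_imp_almost_subset, of "Y \<inter> A0" Y]
    by (intro that[of "Y \<inter> A0"]) auto
qed

text \<open>The successor function of a pseudo-intersection of increasingly sparse sets grows fast.\<close>
lemma bounded_family:
  fixes f :: "'i \<Rightarrow> nat \<Rightarrow> nat"
  assumes J: "|J| \<le>o |B|"
  obtains g where "\<And>i. i \<in> J \<Longrightarrow> eventually (\<lambda>n. f i n \<le> g n) (tail UNIV)"
proof -
  \<comment> \<open>The running maximum replaces \<open>f i\<close> by a monotone majorant.\<close>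
  define h where "h = (\<lambda>i n. Max (f i ` {..n}))"
  have mono_h: "mono (h i)" for i unfolding h_def
    by (intro monoI Max_mono) auto
  have f_le: "f i n \<le> h i n" for i n unfolding h_def by (intro Max_ge) auto
  define r where "r = |J|"
  have wo: "Well_order r" and Fr: "Field r = J"
    unfolding r_def by (rule card_of_Well_order) (rule Field_card_of)
  obtain X where X: "\<And>a. a \<in> Field r \<Longrightarrow>
        infinite (X a) \<and> (\<forall>x\<in>X a. \<forall>y\<in>X a. x < y \<longrightarrow> h a x < y)"
    and dec: "\<And>a b. a \<in> Field r \<Longrightarrow> b \<in> underS r a \<Longrightarrow> X a \<subseteq>\<^sub>* X b"
  proof (rule well_order_construct[OF wo,
        where I = "\<lambda>a X. infinite X \<and> (\<forall>x\<in>X. \<forall>y\<in>X. x < y \<longrightarrow> h a x < y)"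
        and R = "\<lambda>b a Xb Xa. Xa \<subseteq>\<^sub>* Xb"])
    fix a and Z :: "'i \<Rightarrow> nat set"
    assume a: "a \<in> Field r"
      and inf: "\<forall>b\<in>underS r a. infinite (Z b) \<and> (\<forall>x\<in>Z b. \<forall>y\<in>Z b. x < y \<longrightarrow> h b x < y)"
      and dec: "\<forall>b\<in>underS r a. \<forall>c\<in>underS r b. Z b \<subseteq>\<^sub>* Z c"
    obtain A' where A': "infinite A'" "\<And>b. b \<in> underS r a \<Longrightarrow> A' \<subseteq>\<^sub>* Z b"
    proof (rule tower_lower_bound[OF wo, of "underS r a" UNIV Z])
      show "|underS r a| \<le>o |B|" using J by (simp add: card_of_underS_ordLeq Fr)
    qed (use inf dec in \<open>auto dest: mem_underS_Field\<close>)
    obtain X where "infinite X" "X \<subseteq> A'" "\<And>x y. x \<in> X \<Longrightarrow> y \<in> X \<Longrightarrow> x < y \<Longrightarrow> h a x < y"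
      using infinite_sparse_subset[OF A'(1) mono_h] by blast
    then show "\<exists>X. (infinite X \<and> (\<forall>x\<in>X. \<forall>y\<in>X. x < y \<longrightarrow> h a x < y)) \<and>
        (\<forall>b\<in>underS r a. X \<subseteq>\<^sub>* Z b)"
      using A'(2) almost_subset_trans subset_imp_almost_subset by (intro exI[of _ X]) blast
  qed blast
  obtain Y where Y: "infinite Y" "\<And>a. a \<in> J \<Longrightarrow> Y \<subseteq>\<^sub>* X a"
  proof (rule tower_lower_bound[OF wo, of J UNIV X])
  qed (use X dec J Fr in auto)
  \<comment> \<open>The next element of \<open>Y\<close> after \<open>n\<close>. It is applied twice
    below because sparseness compares two elements of \<open>X i\<close>, and \<open>n\<close>
    itself need not be one.\<close>
  define nx where "nx = (\<lambda>n. LEAST y. y \<in> Y \<and> n < y)"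
  have nx: "nx n \<in> Y" "n < nx n" for n
  proof -
    have "\<exists>y. y \<in> Y \<and> n < y" using Y(1) by (meson infinite_nat_iff_unbounded)
    from LeastI_ex[OF this] show "nx n \<in> Y" "n < nx n" by (auto simp: nx_def)
  qed
  have "eventually (\<lambda>n. f i n \<le> nx (nx n)) (tail UNIV)" if i: "i \<in> J" for i
  proof -
    have "finite (Y - X i)" using Y(2)[OF i] by (simp add: almost_subset_def)
    then obtain N where N: "\<And>y. y \<in> Y \<Longrightarrow> N < y \<Longrightarrow> y \<in> X i"
      by (metis DiffI finite_nat_set_iff_bounded less_imp_le not_less)
    have "f i n \<le> nx (nx n)" if "N \<le> n" for n
    proof -
      have "nx n \<in> X i" "nx (nx n) \<in> X i"
        using N nx that by (meson le_less_trans less_trans)+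
      then have "h i (nx n) < nx (nx n)" using X i nx Fr by simp
      moreover have "h i n \<le> h i (nx n)" using mono_h nx(2) by (meson less_imp_le monoD)
      ultimately show ?thesis using f_le[of i n] by linarith
    qed
    then have "{n \<in> UNIV. \<not> f i n \<le> nx (nx n)} \<subseteq> {..N}"
      by (auto simp: not_le) (meson not_le less_imp_le)
    then show ?thesis unfolding eventually_tail by (rule finite_subset) simp
  qed
  then show ?thesis by (rule that)
qed

section \<open>Upper bounds of increasing sequences, and saturation\<close>

text \<open>By transitivity of \<open>R\<close> the regions above the \<open>c a\<close> form a
  tower, and a selector of its pseudo-intersection is the bound. Each \<open>c a\<close> matters
  only on its own \<open>A a\<close>, so a lower bound \<open>A1\<close> of these sets is taken
  first.\<close>

lemma upper_bound:
  fixes r :: "'i rel" and c :: "'i \<Rightarrow> nat \<Rightarrow> 'b::countable"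
  assumes wo: "Well_order r" and J: "J \<subseteq> Field r" "|J| \<le>o |B|" and A0: "infinite A0"
    and A: "\<And>a. a \<in> J \<Longrightarrow> infinite (A a)" "\<And>a. a \<in> J \<Longrightarrow> A a \<subseteq> A0"
    and dec: "\<And>a b. a \<in> J \<Longrightarrow> b \<in> J \<Longrightarrow> b \<in> underS r a \<Longrightarrow> A a \<subseteq>\<^sub>* A b"
    and R: "transp R"
    and refl: "\<And>a. a \<in> J \<Longrightarrow> eventually (\<lambda>n. R (c a n) (c a n)) (tail (A a))"
    and inc: "\<And>a b. a \<in> J \<Longrightarrow> b \<in> J \<Longrightarrow> b \<in> underS r a \<Longrightarrow>
      eventually (\<lambda>n. R (c b n) (c a n)) (tail (A a))"
  obtains A' c' where "infinite A'" "A' \<subseteq> A0" "\<And>a. a \<in> J \<Longrightarrow> A' \<subseteq>\<^sub>* A a"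
    "\<And>a. a \<in> J \<Longrightarrow> eventually (\<lambda>n. R (c a n) (c' n)) (tail A')"
proof (cases "J = {}")
  case True
  with A0 that show ?thesis by blast
next
  case False
  then obtain j where j: "j \<in> J" by blast
  obtain A1 where A1: "infinite A1" "A1 \<subseteq> A0" "\<And>a. a \<in> J \<Longrightarrow> A1 \<subseteq>\<^sub>* A a"
    by (rule tower_lower_bound[OF wo J A0, of A]) (use A dec in auto)
  \<comment> \<open>The cap \<open>g\<close> on the codes makes the columns finite. This is used
    both for the finiteness of \<open>S a - S b\<close> and for the selector.\<close>
  obtain g where g: "\<And>a. a \<in> J \<Longrightarrow> eventually (\<lambda>n. to_nat (c a n) \<le> g n) (tail UNIV)"
    using bounded_family[OF J(2), of "\<lambda>a n. to_nat (c a n)"] by blast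
  define S where "S = (\<lambda>a. encode A1 (\<lambda>n x. to_nat x \<le> g n \<and> R (c a n) x))"
  have S_inf: "infinite (S a)" if a: "a \<in> J" for a
    unfolding S_def
  proof (rule infinite_encode[OF A1(1)])
    have "eventually (\<lambda>n. to_nat (c a n) \<le> g n) (tail A1)"
      using g[OF a] by (rule eventually_tail_mono) (simp add: subset_imp_almost_subset)
    moreover have "eventually (\<lambda>n. R (c a n) (c a n)) (tail A1)"
      using refl[OF a] A1(3)[OF a] by (rule eventually_tail_mono)
    ultimately show "eventually (\<lambda>n. \<exists>x. to_nat x \<le> g n \<and> R (c a n) x) (tail A1)"
      by eventually_elim blast
  qed
  let ?U = "encode A1 (\<lambda>n (x::'b). to_nat x \<le> g n)"
  have S_sub: "S a \<subseteq> ?U" for a by (auto simp: S_def encode_def)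
  have "infinite ?U" using S_inf[OF j] S_sub[of j] finite_subset by blast
  have S_dec: "S a \<subseteq>\<^sub>* S b" if ab: "a \<in> J" "b \<in> J" "b \<in> underS r a" for a b
  proof -
    let ?E = "{n \<in> A1. \<not> R (c b n) (c a n)}"
    have "eventually (\<lambda>n. R (c b n) (c a n)) (tail A1)"
      using inc[OF ab] A1(3)[OF ab(1)] by (rule eventually_tail_mono)
    then have "finite ?E" by (simp add: eventually_tail)
    then have "finite (prod_encode ` (SIGMA n:?E. {..g n}))" by simp
    moreover have "S a - S b \<subseteq> prod_encode ` (SIGMA n:?E. {..g n})"
    proof
      fix y assume y: "y \<in> S a - S b"
      then obtain n x where nx: "y = prod_encode (n, to_nat x)" "n \<in> A1" "to_nat x \<le> g n" "R (c a n) x"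
        by (auto simp: S_def encode_def)
      then have "\<not> R (c b n) x" using y by (auto simp: S_def)
      then have "\<not> R (c b n) (c a n)" using nx(4) R by (meson transpD)
      then show "y \<in> prod_encode ` (SIGMA n:?E. {..g n})" using nx by auto
    qed
    ultimately show ?thesis unfolding almost_subset_def by (rule rev_finite_subset)
  qed
  obtain Y where Y: "infinite Y" "Y \<subseteq> ?U" "\<And>a. a \<in> J \<Longrightarrow> Y \<subseteq>\<^sub>* S a"
    by (rule tower_lower_bound[OF wo J \<open>infinite ?U\<close>, of S]) (use S_inf S_sub S_dec in auto)
  have col: "finite {y \<in> Y. fst (prod_decode y) = n}" for n
  proof (rule finite_subset)
    show "{y \<in> Y. fst (prod_decode y) = n} \<subseteq> prod_encode ` ({n} \<times> {..g n})"
      using Y(2) by (auto simp: encode_def)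
  qed simp
  obtain A' and c' :: "nat \<Rightarrow> 'b" where A': "infinite A'" "A' \<subseteq> A1"
    and c': "\<And>P. Y \<subseteq>\<^sub>* encode A1 P \<Longrightarrow> eventually (\<lambda>n. P n (c' n)) (tail A')"
    using selector_of_encode[OF Y(1,2) col] by blast
  show ?thesis
  proof (rule that[of A' c'])
    fix a assume a: "a \<in> J"
    show "A' \<subseteq>\<^sub>* A a"
      using A'(2) A1(3)[OF a] almost_subset_trans subset_imp_almost_subset by blast
    show "eventually (\<lambda>n. R (c a n) (c' n)) (tail A')"
      using c'[OF Y(3)[OF a, unfolded S_def]] by eventually_elim blast
  qed (use A' A1 in auto)
qed

text \<open>Each condition becomes a region. Finite satisfiability gives the strong finite
  intersection property, and the minimality of \<open>|B|\<close> then supplies a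
  pseudo-intersection.\<close>

lemma saturation:
  fixes P :: "'i \<Rightarrow> nat \<Rightarrow> 'b::countable \<Rightarrow> bool"
  assumes J: "|J| <o |B|" and A0: "infinite A0"
    and fin: "\<And>F. finite F \<Longrightarrow> F \<subseteq> J \<Longrightarrow> eventually (\<lambda>n. \<exists>x. \<forall>i\<in>F. P i n x) (tail A0)"
  obtains A' c where "infinite A'" "A' \<subseteq> A0"
    "\<And>i. i \<in> J \<Longrightarrow> eventually (\<lambda>n. P i n (c n)) (tail A')"
proof (cases "finite J")
  case True
  define c where "c = (\<lambda>n. SOME x. \<forall>i\<in>J. P i n x)"
  have "eventually (\<lambda>n. \<forall>i\<in>J. P i n (c n)) (tail A0)"
    using fin[OF True order.refl] unfolding c_def by (rule eventually_mono) (rule someI_ex)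
  then have "\<And>i. i \<in> J \<Longrightarrow> eventually (\<lambda>n. P i n (c n)) (tail A0)"
    by (auto elim: eventually_mono)
  with A0 that show ?thesis by blast
next
  case False
  then obtain j where j: "j \<in> J" by (metis ex_in_conv finite.emptyI)
  define S where "S = (\<lambda>i. encode A0 (P i))"
  \<comment> \<open>Almost inclusion in every \<open>T k\<close> leaves finitely many points per
    column. Adding these countably many sets keeps the family below \<open>|B|\<close> because
    \<open>J\<close> is infinite here.\<close>
  define T where "T = (\<lambda>k. encode A0 (\<lambda>n (x::'b). k \<le> n))"
  have "\<not> finite B"
    using False J card_of_ordLeq_finite ordLess_imp_ordLeq by blast
  moreover have "|S ` J| <o |B|" using card_of_image J by (rule ordLeq_ordLess_trans)
  moreover have "|range T| <o |B|"
  proof -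
    have "|range T| \<le>o |UNIV::nat set|" by (rule card_of_image)
    also have "|UNIV::nat set| \<le>o |J|" using False infinite_iff_card_of_nat by blast
    finally show ?thesis using J by (rule ordLeq_ordLess_trans)
  qed
  ultimately have "|S ` J \<union> range T| <o |B|" by (rule card_of_Un_ordLess_infinite)
  moreover have "strong_fip (S ` J \<union> range T)"
    unfolding strong_fip_def
  proof (intro allI impI)
    fix C assume "finite C \<and> C \<subseteq> S ` J \<union> range T"
    then have C: "finite (C \<inter> S ` J)" "finite (C \<inter> range T)" "C = (C \<inter> S ` J) \<union> (C \<inter> range T)"
      by auto
    obtain F where F: "F \<subseteq> J" "finite F" "C \<inter> S ` J = S ` F"
      using finite_subset_image[OF C(1) Int_lower2] by blast
    obtain K where K: "finite K" "C \<inter> range T = T ` K"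
      using finite_subset_image[OF C(2) Int_lower2] by blast
    have FK: "finite F" "F \<subseteq> J" "finite K" "C = S ` F \<union> T ` K"
      using F K C(3) by auto
    have "eventually (\<lambda>n. \<forall>k\<in>K. k \<le> n) (tail A0)"
      using FK(3) by (intro eventually_ball_finite) (auto simp: eventually_tail not_le)
    with fin[OF FK(1,2)] have "eventually (\<lambda>n. \<exists>x. (\<forall>i\<in>F. P i n x) \<and> (\<forall>k\<in>K. k \<le> n)) (tail A0)"
      by eventually_elim blast
    then have "infinite (encode A0 (\<lambda>n x. (\<forall>i\<in>F. P i n x) \<and> (\<forall>k\<in>K. k \<le> n)))"
      by (rule infinite_encode[OF A0])
    moreover have "encode A0 (\<lambda>n x. (\<forall>i\<in>F. P i n x) \<and> (\<forall>k\<in>K. k \<le> n)) \<subseteq> \<Inter>C"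
      unfolding FK(4) S_def T_def by (auto simp: encode_def)
    ultimately show "infinite (\<Inter>C)" using finite_subset by blast
  qed
  ultimately obtain Z where Z: "pseudo_intersection Z (S ` J \<union> range T)"
    using small_sfip by blast
  \<comment> \<open>Within \<open>S j\<close> every element codes a pair with first component in
    \<open>A0\<close>, as the selector requires.\<close>
  define Y where "Y = Z \<inter> S j"
  have YZ: "Y \<subseteq>\<^sub>* X" if "X \<in> S ` J \<union> range T" for X
    using Z that almost_subset_trans[OF subset_imp_almost_subset, of Y Z X]
    by (auto simp: pseudo_intersection_def Y_def)
  have "infinite Y"
    using Z j unfolding Y_def pseudo_intersection_def by (intro infinite_almost_subset) auto
  moreover have "Y \<subseteq> encode A0 (P j)" by (simp add: Y_def S_def)
  moreover have "finite {y \<in> Y. fst (prod_decode y) = n}" for n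
  proof (rule finite_subset)
    show "{y \<in> Y. fst (prod_decode y) = n} \<subseteq> Y - T (Suc n)"
      by (auto simp: T_def encode_def)
    show "finite (Y - T (Suc n))" using YZ by (simp add: almost_subset_def)
  qed
  ultimately obtain A' and c :: "nat \<Rightarrow> 'b" where A': "infinite A'" "A' \<subseteq> A0"
    and c: "\<And>P. Y \<subseteq>\<^sub>* encode A0 P \<Longrightarrow> eventually (\<lambda>n. P n (c n)) (tail A')"
    using selector_of_encode[of Y A0 "P j"] by blast
  show ?thesis
    by (rule that[of A' c]) (use A' c YZ in \<open>auto simp: S_def\<close>)
qed

text \<open>\<open>Q\<close> has to hold even if \<open>J\<close> is empty, as at the least stage of
  a recursion. Otherwise it is absorbed into each \<open>P i\<close>.\<close>

lemma saturation_over: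
  fixes P :: "'i \<Rightarrow> nat \<Rightarrow> 'b::countable \<Rightarrow> bool"
  assumes J: "|J| <o |B|" and A0: "infinite A0"
    and fin: "\<And>F. finite F \<Longrightarrow> F \<subseteq> J \<Longrightarrow> eventually (\<lambda>n. \<exists>x. Q n x \<and> (\<forall>i\<in>F. P i n x)) (tail A0)"
  obtains A' c where "infinite A'" "A' \<subseteq> A0" "eventually (\<lambda>n. Q n (c n)) (tail A')"
    "\<And>i. i \<in> J \<Longrightarrow> eventually (\<lambda>n. P i n (c n)) (tail A')"
proof (cases "J = {}")
  case True
  have "eventually (\<lambda>n. \<exists>x. Q n x) (tail A0)"
    using fin[of "{}"] by simp
  then have "eventually (\<lambda>n. Q n (SOME x. Q n x)) (tail A0)"
    by (rule eventually_mono) (rule someI_ex)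
  with A0 True show ?thesis by (intro that[of A0 "\<lambda>n. SOME x. Q n x"]) auto
next
  case False
  then obtain j where j: "j \<in> J" by blast
  obtain A' c where A': "infinite A'" "A' \<subseteq> A0"
    and c: "\<And>i. i \<in> J \<Longrightarrow> eventually (\<lambda>n. Q n (c n) \<and> P i n (c n)) (tail A')"
  proof (rule saturation[OF J A0, of "\<lambda>i n x. Q n x \<and> P i n x"])
    fix F assume F: "finite F" "F \<subseteq> J"
    show "eventually (\<lambda>n. \<exists>x. \<forall>i\<in>F. Q n x \<and> P i n x) (tail A0)"
      using fin[OF F] by (rule eventually_mono) blast
  qed blast
  show ?thesis
  proof (rule that[OF A'])
    show "eventually (\<lambda>n. Q n (c n)) (tail A')"
      using c[OF j] by (rule eventually_mono) blast
    show "eventually (\<lambda>n. P i n (c n)) (tail A')" if "i \<in> J" for i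
      using c[OF that] by (rule eventually_mono) blast
  qed
qed

text \<open>The opening move at stage \<open>a\<close> of the recursions below: a single infinite
  set that serves all earlier stages.\<close>

lemma tower_lower_bound_underS:
  assumes wo: "Well_order r" and small: "\<And>a. a \<in> Field r \<Longrightarrow> |underS r a| <o |B|"
    and "infinite A0" "a \<in> Field r"
    and "\<And>b. b \<in> underS r a \<Longrightarrow> infinite (A b)" "\<And>b. b \<in> underS r a \<Longrightarrow> A b \<subseteq> A0"
    and "\<And>b c. b \<in> underS r a \<Longrightarrow> c \<in> underS r b \<Longrightarrow> A b \<subseteq>\<^sub>* A c"
  obtains A' where "infinite A'" "A' \<subseteq> A0" "\<And>b. b \<in> underS r a \<Longrightarrow> A' \<subseteq>\<^sub>* A b"
proof (rule tower_lower_bound[OF wo, of "underS r a" A0 A])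
  show "|underS r a| \<le>o |B|" using small assms(4) ordLess_imp_ordLeq by blast
qed (use assms that in \<open>auto dest: mem_underS_Field\<close>)

section \<open>Names and the climb along the upper chain\<close>

text \<open>Stage \<open>a\<close> has one condition per predecessor, hence fewer than
  \<open>|B|\<close>, and saturation applies. Finitely many can be met because the earlier names are
  distinct at almost every \<open>n\<close> and \<open>G\<close> takes prescribed values at distinct
  arguments.\<close>

lemma names:
  fixes r :: "'i rel" and v :: "'i \<Rightarrow> 'i \<Rightarrow> nat \<Rightarrow> nat" and G :: "nat \<Rightarrow> nat \<Rightarrow> nat"
  assumes wo: "Well_order r" and small: "\<And>a. a \<in> Field r \<Longrightarrow> |underS r a| <o |B|"
    and le: "|Field r| \<le>o |B|" and A0: "infinite A0"
    and G: "\<And>F k. \<exists>y>k. \<forall>x\<le>k. G x y = F x"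
  obtains A' y where "infinite A'" "A' \<subseteq> A0"
    "\<And>a b. a \<in> Field r \<Longrightarrow> b \<in> underS r a \<Longrightarrow>
      eventually (\<lambda>n. y b n < y a n \<and> G (y b n) (y a n) = v b a n) (tail A')"
proof -
  define good where "good = (\<lambda>b a (y::nat\<Rightarrow>nat) z n. y n < z n \<and> G (y n) (z n) = v b a n)"
  obtain f where f1: "\<And>a. a \<in> Field r \<Longrightarrow> infinite (fst (f a)) \<and> fst (f a) \<subseteq> A0"
    and f2: "\<And>a b. a \<in> Field r \<Longrightarrow> b \<in> underS r a \<Longrightarrow> fst (f a) \<subseteq>\<^sub>* fst (f b) \<and>
      eventually (good b a (snd (f b)) (snd (f a))) (tail (fst (f a)))"
  proof (rule well_order_construct[OF wo,
        where I = "\<lambda>a x. infinite (fst x) \<and> fst x \<subseteq> A0"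
        and R = "\<lambda>b a x z. fst z \<subseteq>\<^sub>* fst x \<and> eventually (good b a (snd x) (snd z)) (tail (fst z))"])
    fix a and f :: "'i \<Rightarrow> nat set \<times> (nat \<Rightarrow> nat)"
    assume a: "a \<in> Field r"
      and f1: "\<forall>b\<in>underS r a. infinite (fst (f b)) \<and> fst (f b) \<subseteq> A0"
      and f2: "\<forall>b\<in>underS r a. \<forall>c\<in>underS r b. fst (f b) \<subseteq>\<^sub>* fst (f c) \<and>
        eventually (good c b (snd (f c)) (snd (f b))) (tail (fst (f b)))"
    obtain A1 where A1: "infinite A1" "A1 \<subseteq> A0" "\<And>b. b \<in> underS r a \<Longrightarrow> A1 \<subseteq>\<^sub>* fst (f b)"
      by (rule tower_lower_bound_underS[OF wo small A0 a, of "\<lambda>b. fst (f b)"]) (use f1 f2 in auto)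
    define y where "y = (\<lambda>b. snd (f b))"
    have inc: "eventually (\<lambda>n. y c n < y b n) (tail A1)"
      if "b \<in> underS r a" "c \<in> underS r b" for b c
    proof -
      have "eventually (good c b (snd (f c)) (snd (f b))) (tail (fst (f b)))"
        using f2 that by blast
      then have "eventually (good c b (snd (f c)) (snd (f b))) (tail A1)"
        using A1(3)[OF that(1)] by (rule eventually_tail_mono)
      then show ?thesis by (rule eventually_mono) (auto simp: good_def y_def)
    qed
    obtain A' z where A': "infinite A'" "A' \<subseteq> A1"
      and z: "\<And>b. b \<in> underS r a \<Longrightarrow>
        eventually (\<lambda>n. y b n < z n \<and> G (y b n) (z n) = v b a n) (tail A')"
    proof (rule saturation[OF small[OF a] A1(1),
          of "\<lambda>b n x. y b n < x \<and> G (y b n) x = v b a n"])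
      fix F assume F: "finite F" "F \<subseteq> underS r a"
      have "eventually (\<lambda>n. \<forall>b\<in>F. \<forall>c\<in>F. c \<in> underS r b \<longrightarrow> y c n < y b n) (tail A1)"
      proof (intro eventually_ball_finite F(1) ballI)
        fix b c assume "b \<in> F" "c \<in> F"
        then show "eventually (\<lambda>n. c \<in> underS r b \<longrightarrow> y c n < y b n) (tail A1)"
          using inc[of b c] F(2) by (cases "c \<in> underS r b") auto
      qed
      then show "eventually (\<lambda>n. \<exists>x. \<forall>b\<in>F. y b n < x \<and> G (y b n) x = v b a n) (tail A1)"
      proof (rule eventually_mono)
        fix n assume *: "\<forall>b\<in>F. \<forall>c\<in>F. c \<in> underS r b \<longrightarrow> y c n < y b n"
        have inj: "inj_on (\<lambda>b. y b n) F"
        proof (rule inj_onI)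
          fix b c assume bc: "b \<in> F" "c \<in> F" "y b n = y c n"
          have "b \<in> Field r" "c \<in> Field r"
            using mem_underS_Field[OF subsetD[OF F(2)]] bc(1,2) by auto
          from wo_trichotomy[OF wo this] show "b = c" using * bc by (metis less_irrefl)
        qed
        have inv: "inv_into F (\<lambda>b. y b n) (y b n) = b" if "b \<in> F" for b
          by (rule inv_into_f_f[OF inj that])
        define k where "k = Max ((\<lambda>b. y b n) ` F)"
        have k: "y b n \<le> k" if "b \<in> F" for b using F(1) that by (simp add: k_def)
        \<comment> \<open>The prescription must be a function of the numbers \<open>y b n\<close>;
          by injectivity \<open>inv_into\<close> recovers the stage \<open>b\<close> from its
          number.\<close>
        obtain x where "x > k" "\<forall>z\<le>k. G z x = v (inv_into F (\<lambda>b. y b n) z) a n"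
          using G[of k "\<lambda>z. v (inv_into F (\<lambda>b. y b n) z) a n"] by blast
        then show "\<exists>x. \<forall>b\<in>F. y b n < x \<and> G (y b n) x = v b a n"
          using k inv by (intro exI[of _ x]) (auto intro: le_less_trans)
      qed
    qed blast
    have "A' \<subseteq>\<^sub>* fst (f b)" if "b \<in> underS r a" for b
      using A'(2) A1(3)[OF that] almost_subset_trans subset_imp_almost_subset by blast
    then show "\<exists>x. (infinite (fst x) \<and> fst x \<subseteq> A0) \<and> (\<forall>b\<in>underS r a. fst x \<subseteq>\<^sub>* fst (f b) \<and>
        eventually (good b a (snd (f b)) (snd x)) (tail (fst x)))"
      using A' A1(2) z by (intro exI[of _ "(A', z)"]) (auto simp: good_def y_def)
  qed blast
  obtain A' where A': "infinite A'" "A' \<subseteq> A0" "\<And>a. a \<in> Field r \<Longrightarrow> A' \<subseteq>\<^sub>* fst (f a)"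
    by (rule tower_lower_bound[OF wo order.refl le A0, of "\<lambda>a. fst (f a)"]) (use f1 f2 in auto)
  show ?thesis
  proof (rule that[OF A'(1,2), of "\<lambda>a. snd (f a)"])
    fix a b assume ab: "a \<in> Field r" "b \<in> underS r a"
    have "eventually (good b a (snd (f b)) (snd (f a))) (tail A')"
      using f2[OF ab] A'(3)[OF ab(1)] eventually_tail_mono by blast
    then show "eventually (\<lambda>n. snd (f b) n < snd (f a) n \<and> G (snd (f b) n) (snd (f a) n) = v b a n) (tail A')"
      by (simp add: good_def)
  qed
qed

text \<open>The node of stage \<open>a\<close> ends, at position \<open>N a\<close>, in an entry
  with bound \<open>e a\<close> and name \<open>y a\<close>, and the names of earlier stages persist
  up to there. \<open>s\<close> is an upper bound of all these nodes and may continue past every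
  \<open>N a\<close>.\<close>

lemma path_of_nodes:
  fixes r :: "'i rel" and G :: "nat \<Rightarrow> nat \<Rightarrow> nat" and y e :: "'i \<Rightarrow> nat \<Rightarrow> nat"
  assumes wo: "Well_order r" and small: "\<And>a. a \<in> Field r \<Longrightarrow> |underS r a| <o |B|"
    and le: "|Field r| \<le>o |B|" and A0: "infinite A0"
    and pairs: "\<And>a b c. a \<in> Field r \<Longrightarrow> b \<in> Field r \<Longrightarrow> c \<in> underS r b \<Longrightarrow>
      eventually (\<lambda>n. y c n < y b n \<and> G (y c n) (y b n) \<le> e a n) (tail A0)"
    and e: "\<And>a b. a \<in> Field r \<Longrightarrow> b \<in> underS r a \<Longrightarrow> eventually (\<lambda>n. e a n \<le> e b n) (tail A0)"
  obtains A' s N where "infinite A'" "A' \<subseteq> A0"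
    "\<And>a. a \<in> Field r \<Longrightarrow> eventually (\<lambda>n. node G (s n) \<and> N a n < length (s n) \<and>
      fst (s n ! N a n) = e a n \<and> y a n \<in> set (snd (s n ! N a n))) (tail A')"
    "\<And>a b. a \<in> Field r \<Longrightarrow> b \<in> underS r a \<Longrightarrow> eventually (\<lambda>n. N b n \<le> N a n \<and>
      (\<forall>j. N b n \<le> j \<and> j \<le> N a n \<longrightarrow> y b n \<in> set (snd (s n ! j)))) (tail A')"
proof -
  define ends where "ends = (\<lambda>a n s. s \<noteq> [] \<and> node G s \<and> fst (last s) = e a n \<and> y a n \<in> set (snd (last s)))"
  \<comment> \<open>The condition \<open>length s \<le> Suc j\<close> starts at the last entry of
    \<open>s\<close> itself, not after it.\<close>
  define ext where "ext = (\<lambda>b n s (t :: (nat \<times> nat list) list). prefix s t \<and>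
    (\<forall>j. length s \<le> Suc j \<and> j < length t \<longrightarrow> y b n \<in> set (snd (t ! j))))"
  obtain f where f1: "\<And>a. a \<in> Field r \<Longrightarrow> infinite (fst (f a)) \<and> fst (f a) \<subseteq> A0 \<and>
      eventually (\<lambda>n. ends a n (snd (f a) n)) (tail (fst (f a)))"
    and f2: "\<And>a b. a \<in> Field r \<Longrightarrow> b \<in> underS r a \<Longrightarrow> fst (f a) \<subseteq>\<^sub>* fst (f b) \<and>
      eventually (\<lambda>n. ext b n (snd (f b) n) (snd (f a) n)) (tail (fst (f a)))"
  proof (rule well_order_construct[OF wo,
        where I = "\<lambda>a x. infinite (fst x) \<and> fst x \<subseteq> A0 \<and> eventually (\<lambda>n. ends a n (snd x n)) (tail (fst x))"
        and R = "\<lambda>b a x z. fst z \<subseteq>\<^sub>* fst x \<and> eventually (\<lambda>n. ext b n (snd x n) (snd z n)) (tail (fst z))"])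
    fix a and f :: "'i \<Rightarrow> nat set \<times> (nat \<Rightarrow> (nat \<times> nat list) list)"
    assume a: "a \<in> Field r"
      and f1: "\<forall>b\<in>underS r a. infinite (fst (f b)) \<and> fst (f b) \<subseteq> A0 \<and>
        eventually (\<lambda>n. ends b n (snd (f b) n)) (tail (fst (f b)))"
      and f2: "\<forall>b\<in>underS r a. \<forall>c\<in>underS r b. fst (f b) \<subseteq>\<^sub>* fst (f c) \<and>
        eventually (\<lambda>n. ext c n (snd (f c) n) (snd (f b) n)) (tail (fst (f b)))"
    obtain A1 where A1: "infinite A1" "A1 \<subseteq> A0" "\<And>b. b \<in> underS r a \<Longrightarrow> A1 \<subseteq>\<^sub>* fst (f b)"
      by (rule tower_lower_bound_underS[OF wo small A0 a, of "\<lambda>b. fst (f b)"]) (use f1 f2 in auto)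
    define c where "c = (\<lambda>b. snd (f b))"
    have A1_0: "A1 \<subseteq>\<^sub>* A0" using A1(2) by (rule subset_imp_almost_subset)
    have c1: "eventually (\<lambda>n. ends b n (c b n)) (tail A1)" if "b \<in> underS r a" for b
      using f1 that A1(3)[OF that] eventually_tail_mono unfolding c_def by blast
    have c2: "eventually (\<lambda>n. ext d n (c d n) (c b n)) (tail A1)"
      if "b \<in> underS r a" "d \<in> underS r b" for b d
      using f2 that A1(3)[OF that(1)] eventually_tail_mono unfolding c_def by blast
    have ex: "eventually (\<lambda>n. \<exists>s. ends a n s \<and> (\<forall>b\<in>F. ext b n (c b n) s)) (tail A1)"
      if F: "finite F" "F \<subseteq> underS r a" for F
    proof (cases "F = {}")
      case True
      have "ends a n [(e a n, [y a n])]" for n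
        by (simp add: ends_def node_def)
      then have "\<exists>s. ends a n s \<and> (\<forall>b\<in>F. ext b n (c b n) s)" for n
        using True by blast
      then show ?thesis by (rule always_eventually[OF allI])
    next
      case False
      have FF: "F \<subseteq> Field r" using F(2) by (auto dest: mem_underS_Field)
      \<comment> \<open>The node of the last stage in \<open>F\<close> extends the other nodes, so
        it suffices to append one entry to it.\<close>
      obtain m where m: "m \<in> F" "\<And>b. b \<in> F \<Longrightarrow> b = m \<or> b \<in> underS r m"
        using wo_finite_max[OF wo F(1) False FF] by blast
      have ma: "m \<in> underS r a" using m(1) F(2) by blast
      have "eventually (\<lambda>n. \<forall>b\<in>insert a F. \<forall>d\<in>insert a F. d \<in> underS r b \<longrightarrow>
          y d n < y b n \<and> G (y d n) (y b n) \<le> e a n) (tail A1)"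
      proof (intro eventually_ball_finite ballI)
        fix b d assume "b \<in> insert a F" "d \<in> insert a F"
        then have "b \<in> Field r" using a FF by auto
        then show "eventually (\<lambda>n. d \<in> underS r b \<longrightarrow> y d n < y b n \<and> G (y d n) (y b n) \<le> e a n) (tail A1)"
          using eventually_tail_mono[OF pairs[OF a, of b d] A1_0] by (cases "d \<in> underS r b") auto
      qed (use F(1) in auto)
      moreover have "eventually (\<lambda>n. \<forall>b\<in>F. b \<in> underS r m \<longrightarrow> ext b n (c b n) (c m n)) (tail A1)"
      proof (intro eventually_ball_finite ballI)
        fix b assume "b \<in> F"
        then show "eventually (\<lambda>n. b \<in> underS r m \<longrightarrow> ext b n (c b n) (c m n)) (tail A1)"
          using c2[OF ma, of b] by (cases "b \<in> underS r m") auto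
      qed (use F(1) in auto)
      moreover have "eventually (\<lambda>n. e a n \<le> e m n) (tail A1)"
        using e[OF a ma] A1_0 by (rule eventually_tail_mono)
      moreover note c1[OF ma]
      ultimately show ?thesis
      proof eventually_elim
        case (elim n)
        \<comment> \<open>The new entry repeats the names of all stages in \<open>F\<close> so that
          they persist, and adds that of \<open>a\<close>. By \<open>pairs\<close>, \<open>G\<close>
          stays below the new bound on them.\<close>
        obtain l where l: "set l = insert a F" using F(1) by (metis finite_insert finite_list)
        define D where "D = map (\<lambda>b. y b n) l"
        have D: "set D = (\<lambda>b. y b n) ` insert a F" by (simp add: D_def l)
        let ?s = "c m n @ [(e a n, D)]"
        have "node G ?s"
        proof (rule node_snoc)
          show "node G (c m n)" "c m n = [] \<or> e a n \<le> fst (last (c m n))"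
            using elim by (auto simp: ends_def)
          fix x z assume "x \<in> set D" "z \<in> set D" "x < z"
          then obtain b d where bd: "b \<in> insert a F" "d \<in> insert a F" "x = y d n" "z = y b n"
            unfolding D by blast
          then have "b \<in> Field r" "d \<in> Field r" using a FF by auto
          from wo_trichotomy[OF wo this] have "d \<in> underS r b"
            using elim(1) bd \<open>x < z\<close> by (metis less_irrefl less_asym)
          then show "G x z \<le> e a n" using elim(1) bd by blast
        qed
        then have "ends a n ?s" by (simp add: ends_def D)
        moreover have "ext b n (c b n) ?s" if "b \<in> F" for b
        proof -
          have pre: "prefix (c b n) (c m n)" using m(2)[OF \<open>b \<in> F\<close>] elim(2) \<open>b \<in> F\<close>
            by (auto simp: ext_def)
          have "y b n \<in> set (snd (?s ! j))" if j: "length (c b n) \<le> Suc j" "j < length ?s" for j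
          proof (cases "j < length (c m n)")
            case True
            show ?thesis
            proof (cases "b = m")
              case True
              \<comment> \<open>Only the last position of the node of \<open>m\<close> is concerned,
                where \<open>ends\<close> puts the name of \<open>m\<close>.\<close>
              have "length (c m n) \<le> Suc j" using j(1) True by simp
              with \<open>j < length (c m n)\<close> have "j = length (c m n) - 1" by linarith
              then show ?thesis using elim(4) \<open>j < length (c m n)\<close> True
                by (auto simp: ends_def nth_append last_conv_nth)
            next
              case False
              then have "ext b n (c b n) (c m n)" using m(2)[OF \<open>b \<in> F\<close>] elim(2) \<open>b \<in> F\<close> by blast
              then show ?thesis using j(1) True by (auto simp: ext_def nth_append)
            qed
          next
            case False
            then have "?s ! j = (e a n, D)" using j(2) by (simp add: nth_append)
            then show ?thesis using \<open>b \<in> F\<close> by (simp add: D)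
          qed
          then show ?thesis using pre by (auto simp: ext_def prefix_def)
        qed
        ultimately show ?case by blast
      qed
    qed
    obtain A' s where A': "infinite A'" "A' \<subseteq> A1"
      and s: "eventually (\<lambda>n. ends a n (s n)) (tail A')"
        "\<And>b. b \<in> underS r a \<Longrightarrow> eventually (\<lambda>n. ext b n (c b n) (s n)) (tail A')"
      using saturation_over[OF small[OF a] A1(1), of "\<lambda>n s. ends a n s" "\<lambda>b n s. ext b n (c b n) s", OF ex]
      by blast
    have "A' \<subseteq>\<^sub>* fst (f b)" if "b \<in> underS r a" for b
      using A'(2) A1(3)[OF that] almost_subset_trans subset_imp_almost_subset by blast
    then show "\<exists>x. (infinite (fst x) \<and> fst x \<subseteq> A0 \<and> eventually (\<lambda>n. ends a n (snd x n)) (tail (fst x))) \<and>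
        (\<forall>b\<in>underS r a. fst x \<subseteq>\<^sub>* fst (f b) \<and>
          eventually (\<lambda>n. ext b n (snd (f b) n) (snd x n)) (tail (fst x)))"
      using A' A1(2) s by (intro exI[of _ "(A', s)"]) (auto simp: c_def)
  qed blast
  define c where "c = (\<lambda>a. snd (f a))"
  define N where "N = (\<lambda>a n. length (c a n) - 1)"
  \<comment> \<open>Including \<open>node G t\<close> in the relation makes the upper bound a node
    as well.\<close>
  let ?R = "\<lambda>s t. node G t \<and> prefix s t"
  obtain A' s where A': "infinite A'" "A' \<subseteq> A0" "\<And>a. a \<in> Field r \<Longrightarrow> A' \<subseteq>\<^sub>* fst (f a)"
    and s: "\<And>a. a \<in> Field r \<Longrightarrow> eventually (\<lambda>n. ?R (c a n) (s n)) (tail A')"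
  proof (rule upper_bound[OF wo order.refl le A0, of "\<lambda>a. fst (f a)" ?R c])
    show "transp ?R" by (auto intro!: transpI)
    show "eventually (\<lambda>n. ?R (c a n) (c a n)) (tail (fst (f a)))" if "a \<in> Field r" for a
      using f1[OF that] by (auto simp: ends_def c_def elim: eventually_mono)
    show "eventually (\<lambda>n. ?R (c b n) (c a n)) (tail (fst (f a)))"
      if "a \<in> Field r" "b \<in> underS r a" for a b
    proof -
      have "eventually (\<lambda>n. ends a n (c a n)) (tail (fst (f a)))"
        "eventually (\<lambda>n. ext b n (c b n) (c a n)) (tail (fst (f a)))"
        using f1[OF that(1)] f2[OF that] by (auto simp: c_def)
      then show ?thesis by eventually_elim (auto simp: ends_def ext_def)
    qed
  qed (use f1 f2 in auto)
  have ends: "eventually (\<lambda>n. ends a n (c a n)) (tail A')" if "a \<in> Field r" for a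
    using f1[OF that] A'(3)[OF that] eventually_tail_mono unfolding c_def by blast
  have ext: "eventually (\<lambda>n. ext b n (c b n) (c a n)) (tail A')"
    if "a \<in> Field r" "b \<in> underS r a" for a b
    using f2[OF that] A'(3)[OF that(1)] eventually_tail_mono unfolding c_def by blast
  have nth: "s ! j = t ! j" if "prefix t s" "j < length t" for s t :: "(nat \<times> nat list) list" and j
    using that by (auto simp: prefix_def nth_append)
  show ?thesis
  proof (rule that[OF A'(1,2), of s N])
    fix a assume a: "a \<in> Field r"
    show "eventually (\<lambda>n. node G (s n) \<and> N a n < length (s n) \<and>
      fst (s n ! N a n) = e a n \<and> y a n \<in> set (snd (s n ! N a n))) (tail A')"
      using s[OF a] ends[OF a]
    proof eventually_elim
      case (elim n)
      have N: "N a n < length (c a n)" "c a n ! N a n = last (c a n)"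
        using elim(2) by (auto simp: N_def ends_def last_conv_nth)
      moreover have "length (c a n) \<le> length (s n)" using elim(1) by (auto dest: prefix_length_le)
      ultimately show ?case using elim nth[of "c a n" "s n" "N a n"] by (auto simp: ends_def)
    qed
    fix b assume b: "b \<in> underS r a"
    show "eventually (\<lambda>n. N b n \<le> N a n \<and>
      (\<forall>j. N b n \<le> j \<and> j \<le> N a n \<longrightarrow> y b n \<in> set (snd (s n ! j)))) (tail A')"
      using s[OF a] ends[OF a] ext[OF a b]
    proof eventually_elim
      case (elim n)
      have ne: "c a n \<noteq> []" using elim(2) by (simp add: ends_def)
      have "length (c b n) \<le> length (c a n)" using elim(3) by (auto simp: ext_def dest: prefix_length_le)
      then have "N b n \<le> N a n" by (simp add: N_def)
      moreover have "y b n \<in> set (snd (s n ! j))" if j: "N b n \<le> j" "j \<le> N a n" for j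
      proof -
        have "j < length (c a n)" using j(2) ne by (cases "c a n") (auto simp: N_def)
        moreover have "length (c b n) \<le> Suc j" using j(1) by (simp add: N_def)
        ultimately have "y b n \<in> set (snd (c a n ! j))" using elim(3) by (auto simp: ext_def)
        then show ?thesis using nth[of "c a n" "s n" j] elim(1) \<open>j < length (c a n)\<close> by simp
      qed
      ultimately show ?case by blast
    qed
  qed
qed

section \<open>Interpolation between chains and between families\<close>

text \<open>The lower chain has length below \<open>|B|\<close>, the upper one length exactly
  \<open>|B|\<close>; this difference drives the pigeonhole. That \<open>q\<close> and
  \<open>r\<close> are cardinals makes their proper initial segments small.\<close>

lemma gap_filled:
  fixes q :: "'k rel" and r :: "'i rel" and d :: "'k \<Rightarrow> nat \<Rightarrow> nat" and e :: "'i \<Rightarrow> nat \<Rightarrow> nat"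
  assumes q: "Card_order q" "infinite (Field q)" "|Field q| <o |B|"
    and r: "Card_order r" "|Field r| =o |B|" and A0: "infinite A0"
    and d: "\<And>i j. i \<in> Field q \<Longrightarrow> j \<in> underS q i \<Longrightarrow> eventually (\<lambda>n. d j n \<le> d i n) (tail A0)"
    and e: "\<And>a b. a \<in> Field r \<Longrightarrow> b \<in> underS r a \<Longrightarrow> eventually (\<lambda>n. e a n \<le> e b n) (tail A0)"
    and de: "\<And>i a. i \<in> Field q \<Longrightarrow> a \<in> Field r \<Longrightarrow> eventually (\<lambda>n. d i n \<le> e a n) (tail A0)"
  shows "\<exists>A' f. infinite A' \<and> A' \<subseteq> A0 \<and> (\<forall>i\<in>Field q. eventually (\<lambda>n. d i n \<le> f n) (tail A')) \<and>
    (\<forall>a\<in>Field r. eventually (\<lambda>n. f n \<le> e a n) (tail A'))"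
proof (rule ccontr)
  assume unfilled: "\<nexists>A' f. infinite A' \<and> A' \<subseteq> A0 \<and> (\<forall>i\<in>Field q. eventually (\<lambda>n. d i n \<le> f n) (tail A')) \<and>
    (\<forall>a\<in>Field r. eventually (\<lambda>n. f n \<le> e a n) (tail A'))"
  have wo: "Well_order r" and woq: "Well_order q" using r(1) q(1) by (auto simp: card_order_on_def)
  have rB: "r =o |B|" using r card_of_Field_ordIso ordIso_symmetric ordIso_transitive by blast
  have small: "|underS r a| <o |B|" if "a \<in> Field r" for a
    using card_of_underS[OF r(1) that] rB by (rule ordLess_ordIso_trans)
  have le: "|Field r| \<le>o |B|" using r(2) by (rule ordIso_imp_ordLeq)
  obtain i0 where i0: "i0 \<in> Field q" using q(2) by (metis ex_in_conv finite.emptyI)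
  \<comment> \<open>Where \<open>b\<close> has too many predecessors, \<open>h b\<close> takes
    arbitrary values in \<open>Field q\<close>, so that \<open>d (h b c)\<close> is a term of the
    lower chain in every case.\<close>
  have "\<exists>h. \<forall>b. (\<forall>c. h b c \<in> Field q) \<and>
      ( |underS r b| \<le>o |Field q| \<longrightarrow> inj_on (h b) (underS r b))"
  proof (rule choice, rule allI)
    fix b
    show "\<exists>g. (\<forall>c. g c \<in> Field q) \<and> ( |underS r b| \<le>o |Field q| \<longrightarrow> inj_on g (underS r b))"
    proof (cases "|underS r b| \<le>o |Field q|")
      case True
      then obtain g where g: "inj_on g (underS r b)" "g ` underS r b \<subseteq> Field q"
        using card_of_ordLeq[of "underS r b" "Field q"] by auto
      then show ?thesis using i0
        by (intro exI[of _ "\<lambda>c. if c \<in> underS r b then g c else i0"]) (auto simp: inj_on_def)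
    qed (use i0 in auto)
  qed
  then obtain h where h: "\<And>b c. h b c \<in> Field q"
      "\<And>b. |underS r b| \<le>o |Field q| \<Longrightarrow> inj_on (h b) (underS r b)" by blast
  obtain G :: "nat \<Rightarrow> nat \<Rightarrow> nat" where G: "\<And>F k. \<exists>y>k. \<forall>x\<le>k. G x y = F x"
    using function_decoder by blast
  obtain A1 y where A1: "infinite A1" "A1 \<subseteq> A0"
    and y: "\<And>a b. a \<in> Field r \<Longrightarrow> b \<in> underS r a \<Longrightarrow>
      eventually (\<lambda>n. y b n < y a n \<and> G (y b n) (y a n) = d (h a b) n) (tail A1)"
    by (rule names[OF wo small le A0 G, of "\<lambda>b a. d (h a b)"]) auto
  have A1': "A1 \<subseteq>\<^sub>* A0" using A1(2) by (rule subset_imp_almost_subset)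
  have pairs: "eventually (\<lambda>n. y c n < y b n \<and> G (y c n) (y b n) \<le> e a n) (tail A1)"
    if abc: "a \<in> Field r" "b \<in> Field r" "c \<in> underS r b" for a b c
  proof -
    have "eventually (\<lambda>n. d (h b c) n \<le> e a n) (tail A1)"
      using de[OF h(1) abc(1)] A1' by (rule eventually_tail_mono)
    with y[OF abc(2,3)] show ?thesis by eventually_elim auto
  qed
  have e1: "eventually (\<lambda>n. e a n \<le> e b n) (tail A1)" if "a \<in> Field r" "b \<in> underS r a" for a b
    using e[OF that] A1' by (rule eventually_tail_mono)
  obtain A2 s N where A2: "infinite A2" "A2 \<subseteq> A1"
    and s: "\<And>a. a \<in> Field r \<Longrightarrow> eventually (\<lambda>n. node G (s n) \<and> N a n < length (s n) \<and>
      fst (s n ! N a n) = e a n \<and> y a n \<in> set (snd (s n ! N a n))) (tail A2)"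
    and N: "\<And>a b. a \<in> Field r \<Longrightarrow> b \<in> underS r a \<Longrightarrow> eventually (\<lambda>n. N b n \<le> N a n \<and>
      (\<forall>j. N b n \<le> j \<and> j \<le> N a n \<longrightarrow> y b n \<in> set (snd (s n ! j)))) (tail A2)"
    by (rule path_of_nodes[where y = y and G = G and e = e, OF wo small le A1(1) pairs e1]) auto
  have A2': "A2 \<subseteq>\<^sub>* A0" using A1(2) A2(2) by (auto intro: subset_imp_almost_subset)
  \<comment> \<open>\<open>alive\<close> follows the name \<open>y b\<close> without interruption
    from position \<open>N b\<close>, possibly past every \<open>N a\<close>. \<open>low\<close>
    says that the bound drops below \<open>d i\<close> while the name is still there.\<close>
  define alive where "alive = (\<lambda>b n j. j < length (s n) \<and> N b n \<le> j \<and>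
    (\<forall>i. N b n \<le> i \<and> i \<le> j \<longrightarrow> y b n \<in> set (snd (s n ! i))))"
  define low where "low = (\<lambda>b i n. \<exists>j. alive b n j \<and> fst (s n ! j) < d i n)"
  \<comment> \<open>Otherwise the bound at the last position where \<open>y b\<close> is alive fills
    the gap on \<open>A'\<close>: it is above each \<open>d i\<close> because no
    \<open>low b i\<close> occurs, and below each \<open>e a\<close> because \<open>y b\<close> is
    alive at \<open>N a\<close> for every later \<open>a\<close>.\<close>
  have ex_low: "\<exists>A'' i. infinite A'' \<and> A'' \<subseteq> A' \<and> i \<in> Field q \<and> eventually (low b i) (tail A'')"
    if b: "b \<in> Field r" and A': "infinite A'" "A' \<subseteq> A2" for b A'
  proof (rule ccontr)
    assume none: "\<not> ?thesis"
    have A'2: "A' \<subseteq>\<^sub>* A2" using A'(2) by (rule subset_imp_almost_subset)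
    define m where "m = (\<lambda>n. Max {j. alive b n j})"
    define f where "f = (\<lambda>n. fst (s n ! m n))"
    have alive_N: "eventually (\<lambda>n. node G (s n) \<and> alive b n (N b n)) (tail A')"
      using eventually_tail_mono[OF s[OF b] A'2] by eventually_elim (auto simp: alive_def)
    have fin: "finite {j. alive b n j}" for n
      by (rule finite_subset[of _ "{..<length (s n)}"]) (auto simp: alive_def)
    have "eventually (\<lambda>n. d i n \<le> f n) (tail A')" if i: "i \<in> Field q" for i
    proof -
      have "eventually (\<lambda>n. \<not> low b i n) (tail A')"
      proof (rule ccontr)
        assume "\<not> ?thesis"
        then obtain A'' where A'': "infinite A''" "A'' \<subseteq> A'" "\<And>n. n \<in> A'' \<Longrightarrow> \<not> \<not> low b i n"
          by (rule not_eventually_tail) auto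
        have "eventually (low b i) (tail A'')" by (rule eventually_tailI) (use A''(3) in blast)
        with none A'' i show False by blast
      qed
      with alive_N show ?thesis
      proof eventually_elim
        case (elim n)
        have "alive b n (m n)" using Max_in[OF fin] elim(1) unfolding m_def by blast
        then show ?case using elim(2) unfolding low_def f_def by (meson not_le)
      qed
    qed
    moreover have "eventually (\<lambda>n. f n \<le> e a n) (tail A')" if a: "a \<in> Field r" for a
    proof -
      have fb: "eventually (\<lambda>n. f n \<le> fst (s n ! j n)) (tail A')"
        if "eventually (\<lambda>n. alive b n (j n)) (tail A')" for j
        using alive_N that
      proof eventually_elim
        case (elim n)
        have "alive b n (m n)" using Max_in[OF fin] elim(2) unfolding m_def by blast
        moreover have "j n \<le> m n" using elim(2) fin unfolding m_def by (intro Max_ge) auto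
        ultimately show ?case unfolding f_def
          using node_antimono[of G "s n" "j n" "m n"] elim(1) by (auto simp: alive_def)
      qed
      have feb: "eventually (\<lambda>n. f n \<le> e b n) (tail A')"
      proof -
        have "eventually (\<lambda>n. f n \<le> fst (s n ! N b n)) (tail A')"
          using alive_N by (intro fb) (auto elim: eventually_mono)
        with eventually_tail_mono[OF s[OF b] A'2] show ?thesis by eventually_elim auto
      qed
      consider "a = b" | "a \<in> underS r b" | "b \<in> underS r a"
        using wo_trichotomy[OF wo a b] by blast
      then show ?thesis
      proof cases
        case 1
        then show ?thesis using feb by simp
      next
        case 2
        have "eventually (\<lambda>n. e b n \<le> e a n) (tail A')"
          using e[OF b 2] almost_subset_trans[OF A'2 A2'] by (rule eventually_tail_mono)
        with feb show ?thesis by eventually_elim auto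
      next
        case 3
        note sa = eventually_tail_mono[OF s[OF a] A'2]
        have "eventually (\<lambda>n. alive b n (N a n)) (tail A')"
          using eventually_tail_mono[OF N[OF a 3] A'2] sa
          by eventually_elim (auto simp: alive_def)
        from fb[OF this] sa show ?thesis by eventually_elim auto
      qed
    qed
    moreover have "A' \<subseteq> A0" using A'(2) A2(2) A1(2) by blast
    ultimately show False using unfilled A'(1) by blast
  qed
  \<comment> \<open>The index and the set on which it works depend on \<open>b\<close>. Choosing the
    sets as a tower yields one set \<open>A3\<close> for all stages.\<close>
  obtain g where g1: "\<And>b. b \<in> Field r \<Longrightarrow> infinite (fst (g b)) \<and> fst (g b) \<subseteq> A2 \<and>
      snd (g b) \<in> Field q \<and> eventually (low b (snd (g b))) (tail (fst (g b)))"
    and g2: "\<And>a b. a \<in> Field r \<Longrightarrow> b \<in> underS r a \<Longrightarrow> fst (g a) \<subseteq>\<^sub>* fst (g b)"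
  proof (rule well_order_construct[OF wo,
        where I = "\<lambda>b x. infinite (fst x) \<and> fst x \<subseteq> A2 \<and> snd x \<in> Field q \<and> eventually (low b (snd x)) (tail (fst x))"
        and R = "\<lambda>b a x z. fst z \<subseteq>\<^sub>* fst x"])
    fix a and g :: "'i \<Rightarrow> nat set \<times> 'k"
    assume a: "a \<in> Field r"
      and g1: "\<forall>b\<in>underS r a. infinite (fst (g b)) \<and> fst (g b) \<subseteq> A2 \<and> snd (g b) \<in> Field q \<and>
        eventually (low b (snd (g b))) (tail (fst (g b)))"
      and g2: "\<forall>b\<in>underS r a. \<forall>c\<in>underS r b. fst (g b) \<subseteq>\<^sub>* fst (g c)"
    obtain A' where A': "infinite A'" "A' \<subseteq> A2" "\<And>b. b \<in> underS r a \<Longrightarrow> A' \<subseteq>\<^sub>* fst (g b)"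
      by (rule tower_lower_bound_underS[OF wo small A2(1) a, of "\<lambda>b. fst (g b)"]) (use g1 g2 in auto)
    obtain A'' i where A'': "infinite A''" "A'' \<subseteq> A'" "i \<in> Field q" "eventually (low a i) (tail A'')"
      using ex_low[OF a A'(1,2)] by blast
    have "A'' \<subseteq>\<^sub>* fst (g b)" if "b \<in> underS r a" for b
      using A''(2) A'(3)[OF that] almost_subset_trans subset_imp_almost_subset by blast
    then show "\<exists>x. (infinite (fst x) \<and> fst x \<subseteq> A2 \<and> snd x \<in> Field q \<and> eventually (low a (snd x)) (tail (fst x))) \<and>
        (\<forall>b\<in>underS r a. fst x \<subseteq>\<^sub>* fst (g b))"
      using A'' A'(2) by (intro exI[of _ "(A'', i)"]) auto
  qed blast
  obtain A3 where A3: "infinite A3" "A3 \<subseteq> A2" "\<And>b. b \<in> Field r \<Longrightarrow> A3 \<subseteq>\<^sub>* fst (g b)"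
    by (rule tower_lower_bound[OF wo order.refl le A2(1), of "\<lambda>b. fst (g b)"]) (use g1 g2 in auto)
  have A32: "A3 \<subseteq>\<^sub>* A2" and A31: "A3 \<subseteq>\<^sub>* A1" and A30: "A3 \<subseteq>\<^sub>* A0"
    using A3(2) A2(2) A1(2) by (auto intro: subset_imp_almost_subset)
  define k where "k = (\<lambda>b. snd (g b))"
  have kq: "k b \<in> Field q" if "b \<in> Field r" for b using g1[OF that] by (simp add: k_def)
  have low: "eventually (low b (k b)) (tail A3)" if "b \<in> Field r" for b
    using g1[OF that] A3(3)[OF that] eventually_tail_mono unfolding k_def by blast
  have "|Field q| <o |Field r|" using q(3) r(2) ordIso_symmetric ordLess_ordIso_trans by blast
  then obtain b where b: "b \<in> Field r" "|underS r b| \<le>o |Field q|"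
      "|Field q| \<le>o |{c \<in> underS r b. k c = k b}|"
    using pigeonhole_initial_segment[OF wo q(2), of k] kq by blast
  \<comment> \<open>Otherwise \<open>d (k b) \<le> d (h b c) = G (y c) (y b)\<close>. But
    \<open>b\<close> and \<open>c\<close> share the index \<open>k b\<close>, so both names occur at
    a position whose bound is below \<open>d (k b)\<close>, and that bound limits
    \<open>G\<close>.\<close>
  have "h b c \<in> underS q (k b)" if c: "c \<in> underS r b" "k c = k b" for c
  proof (rule ccontr)
    assume not: "h b c \<notin> underS q (k b)"
    have cr: "c \<in> Field r" using c(1) by (rule mem_underS_Field)
    have N': "eventually (\<lambda>n. N c n \<le> N b n) (tail A3)"
      using eventually_tail_mono[OF N[OF b(1) c(1)] A32] by (rule eventually_mono) blast
    have de': "eventually (\<lambda>n. d (k b) n \<le> e b n) (tail A3)"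
      using de[OF kq[OF b(1)] b(1)] A30 by (rule eventually_tail_mono)
    have "eventually (\<lambda>n. d (k b) n \<le> d (h b c) n) (tail A3)"
      using wo_trichotomy[OF woq h(1)[of b c] kq[OF b(1)]] not d[OF h(1)[of b c], of "k b"]
        eventually_tail_mono[OF _ A30] by (metis (mono_tags, lifting) eventually_mono order.refl always_eventually)
    moreover note low[OF b(1)] low[OF cr] N' de'
      eventually_tail_mono[OF s[OF b(1)] A32] eventually_tail_mono[OF y[OF b(1) c(1)] A31]
    ultimately have "eventually (\<lambda>n. False) (tail A3)"
    proof eventually_elim
      case (elim n)
      obtain j1 where j1: "alive b n j1" "fst (s n ! j1) < d (k b) n" using elim(2) by (auto simp: low_def)
      obtain j2 where j2: "alive c n j2" "fst (s n ! j2) < d (k b) n" using elim(3) c(2) by (auto simp: low_def)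
      \<comment> \<open>The common position is the smaller of \<open>j1\<close> and
        \<open>j2\<close>.\<close>
      have "\<exists>j. fst (s n ! j) < d (k b) n \<and> j < length (s n) \<and>
          y b n \<in> set (snd (s n ! j)) \<and> y c n \<in> set (snd (s n ! j))"
      proof (cases "j1 \<le> j2")
        case True
        then show ?thesis using j1 j2 elim(4) by (intro exI[of _ j1]) (auto simp: alive_def)
      next
        case False
        \<comment> \<open>Before position \<open>N b\<close> the bound is still at least
          \<open>e b\<close>, hence at least \<open>d (k b)\<close>.\<close>
        have "N b n \<le> j2"
        proof (rule ccontr)
          assume "\<not> N b n \<le> j2"
          then have "e b n \<le> fst (s n ! j2)"
            using node_antimono[of G "s n" j2 "N b n"] elim(6) by auto
          then show False using j2(2) elim(5) by linarith
        qed
        then show ?thesis using j1(1) j2 False by (intro exI[of _ j2]) (auto simp: alive_def)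
      qed
      then obtain j where j: "fst (s n ! j) < d (k b) n" "j < length (s n)"
        "y b n \<in> set (snd (s n ! j))" "y c n \<in> set (snd (s n ! j))" by blast
      have "G (y c n) (y b n) \<le> fst (s n ! j)"
        using nodeD[of G "s n" j "y c n" "y b n"] elim(6,7) j by auto
      then show False using elim(1,7) j(1) by auto
    qed
    then show False using A3(1) by (simp add: eventually_tail)
  qed
  \<comment> \<open>Thus \<open>h b\<close> injects \<open>|Field q|\<close> many stages into a
    proper initial segment of the cardinal \<open>q\<close>.\<close>
  then have "h b ` {c \<in> underS r b. k c = k b} \<subseteq> underS q (k b)" by auto
  moreover have "inj_on (h b) {c \<in> underS r b. k c = k b}"
    using h(2)[OF b(2)] by (rule inj_on_subset) auto
  ultimately have "|{c \<in> underS r b. k c = k b}| \<le>o |underS q (k b)|"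
    using card_of_ordLeq by blast
  with b(3) have "|Field q| \<le>o |underS q (k b)|" by (rule ordLeq_transitive)
  also have "|underS q (k b)| <o q" using q(1) kq[OF b(1)] by (rule card_of_underS)
  also have "q =o |Field q|" using q(1) by (rule ordIso_symmetric[OF card_of_Field_ordIso])
  finally show False using ordLess_irreflexive by blast
qed

text \<open>Saturation with one condition per function: at almost every \<open>n\<close>, the
  maximum of finitely many lower values is below finitely many upper ones.\<close>

lemma small_fill:
  fixes L U :: "(nat \<Rightarrow> nat) set"
  assumes B: "infinite B" and L: "|L| <o |B|" and U: "|U| <o |B|" and A0: "infinite A0"
    and LU: "\<And>l u. l \<in> L \<Longrightarrow> u \<in> U \<Longrightarrow> eventually (\<lambda>n. l n \<le> u n) (tail A0)"
  obtains A' f where "infinite A'" "A' \<subseteq> A0" "\<And>l. l \<in> L \<Longrightarrow> eventually (\<lambda>n. l n \<le> f n) (tail A')"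
    "\<And>u. u \<in> U \<Longrightarrow> eventually (\<lambda>n. f n \<le> u n) (tail A')"
proof -
  define P where "P = (\<lambda>i n x. case i of Inl (l :: nat \<Rightarrow> nat) \<Rightarrow> l n \<le> x | Inr (u :: nat \<Rightarrow> nat) \<Rightarrow> x \<le> u n)"
  have card: "|L <+> U| <o |B|" using B L U by (rule card_of_Plus_ordLess_infinite)
  obtain A' f where A': "infinite A'" "A' \<subseteq> A0"
    and f: "\<And>i. i \<in> L <+> U \<Longrightarrow> eventually (\<lambda>n. P i n (f n)) (tail A')"
  proof (rule saturation[OF card A0, of P])
    fix F assume F: "finite F" "F \<subseteq> L <+> U"
    have "eventually (\<lambda>n. \<forall>i\<in>F. \<forall>j\<in>F. \<forall>l u. i = Inl l \<and> j = Inr u \<longrightarrow> l n \<le> u n) (tail A0)"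
    proof (intro eventually_ball_finite F(1) ballI)
      fix i j assume "i \<in> F" "j \<in> F"
      then have "i \<in> L <+> U" "j \<in> L <+> U" using F(2) by blast+
      then show "eventually (\<lambda>n. \<forall>l u. i = Inl l \<and> j = Inr u \<longrightarrow> l n \<le> u n) (tail A0)"
        using LU by (cases i; cases j) auto
    qed
    then show "eventually (\<lambda>n. \<exists>x. \<forall>i\<in>F. P i n x) (tail A0)"
    proof (rule eventually_mono)
      fix n assume *: "\<forall>i\<in>F. \<forall>j\<in>F. \<forall>l u. i = Inl l \<and> j = Inr u \<longrightarrow> l n \<le> u n"
      \<comment> \<open>The extra \<open>0\<close> keeps \<open>Max\<close> defined when
        \<open>F\<close> contains upper conditions only.\<close>
      let ?S = "insert 0 ((\<lambda>l. l n) ` (Inl -` F))"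
      have fin: "finite ?S" using F(1) by (simp add: finite_vimageI)
      have "P i n (Max ?S)" if "i \<in> F" for i
      proof (cases i)
        case (Inl l)
        then show ?thesis using fin that by (auto simp: P_def intro!: Max_ge)
      next
        case (Inr u)
        then have "Max ?S \<le> u n" using fin that * by (subst Max_le_iff) auto
        then show ?thesis using Inr by (simp add: P_def)
      qed
      then show "\<exists>x. \<forall>i\<in>F. P i n x" by blast
    qed
  qed auto
  show ?thesis
  proof (rule that[OF A'])
    show "eventually (\<lambda>n. l n \<le> f n) (tail A')" if "l \<in> L" for l
      using f[of "Inl l"] that by (auto simp: P_def)
    show "eventually (\<lambda>n. f n \<le> u n) (tail A')" if "u \<in> U" for u
      using f[of "Inr u"] that by (auto simp: P_def)
  qed
qed

text \<open>A counterexample with \<open>L\<close> of least cardinality can be thinned to a chain.\<close>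
lemma fill:
  fixes L U :: "(nat \<Rightarrow> nat) set"
  assumes "|L| <o |B|" "|U| \<le>o |B|" "infinite A0"
    "\<And>l u. l \<in> L \<Longrightarrow> u \<in> U \<Longrightarrow> eventually (\<lambda>n. l n \<le> u n) (tail A0)"
  shows "\<exists>A' f. infinite A' \<and> A' \<subseteq> A0 \<and> (\<forall>l\<in>L. eventually (\<lambda>n. l n \<le> f n) (tail A')) \<and>
    (\<forall>u\<in>U. eventually (\<lambda>n. f n \<le> u n) (tail A'))"
  using assms
proof (induction L arbitrary: A0 rule: wf_induct_rule[OF wf_inv_image[OF wf_ordLess, of card_of]])
  case (1 L)
  note L = 1(2) and U = 1(3) and A0 = 1(4) and LU = 1(5)
  have IH: "\<exists>A' f. infinite A' \<and> A' \<subseteq> A1 \<and> (\<forall>l\<in>L'. eventually (\<lambda>n. l n \<le> f n) (tail A')) \<and>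
      (\<forall>u\<in>U. eventually (\<lambda>n. f n \<le> u n) (tail A'))"
    if "|L'| <o |L|" "infinite A1" "\<And>l u. l \<in> L' \<Longrightarrow> u \<in> U \<Longrightarrow> eventually (\<lambda>n. l n \<le> u n) (tail A1)"
    for L' A1
    using that(1) ordLess_transitive[OF that(1) L] U that(2,3)
    by (intro 1(1)) (auto simp: inv_image_def)
  show ?case
  proof (cases "finite L")
    case True
    define f where "f = (\<lambda>n. Max (insert 0 ((\<lambda>l. l n) ` L)))"
    have "\<forall>l\<in>L. eventually (\<lambda>n. l n \<le> f n) (tail A0)"
      using True by (auto simp: f_def intro!: always_eventually Max_ge)
    moreover have "eventually (\<lambda>n. f n \<le> u n) (tail A0)" if u: "u \<in> U" for u
    proof -
      have "eventually (\<lambda>n. \<forall>l\<in>L. l n \<le> u n) (tail A0)"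
        using True LU u by (intro eventually_ball_finite) auto
      then show ?thesis using True unfolding f_def by (auto elim!: eventually_mono)
    qed
    ultimately show ?thesis using A0 by blast
  next
    case inf: False
    have "infinite B" using inf L card_of_ordLeq_finite ordLess_imp_ordLeq by blast
    show ?thesis
    proof (cases "|U| <o |B|")
      case True
      show ?thesis
        by (rule small_fill[OF \<open>infinite B\<close> L True A0 LU]) blast+
    next
      case False
      then have UB: "|U| =o |B|" using U by (simp add: ordLeq_iff_ordLess_or_ordIso)
      define q where "q = card_of L"
      have q: "Card_order q" "Field q = L" "Well_order q"
        unfolding q_def by (rule card_of_Card_order, rule Field_card_of, rule card_of_Well_order)
      define r where "r = card_of U"
      have r: "Card_order r" "Field r = U" "Well_order r"
        unfolding r_def by (rule card_of_Card_order, rule Field_card_of, rule card_of_Well_order)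
      have small_q: "|underS q l| <o |L|" if "l \<in> Field q" for l
        using card_of_underS[OF q(1) that] by (simp add: q_def)
      have small_r: "|underS r u| <o |B|" if "u \<in> Field r" for u
        using card_of_underS[OF r(1) that] UB unfolding r_def by (rule ordLess_ordIso_trans)
      have small_q': "|underS q l| <o |B|" if "l \<in> Field q" for l
        using small_q[OF that] L by (rule ordLess_transitive)
      \<comment> \<open>Thinning the lower side: stage \<open>l\<close> interpolates between
        \<open>U\<close> and the set of \<open>l\<close> and all earlier choices. That set has fewer
        than \<open>|L|\<close> members, so \<open>IH\<close> applies.\<close>
      obtain g where g1: "\<And>l. l \<in> Field q \<Longrightarrow> infinite (fst (g l)) \<and> fst (g l) \<subseteq> A0 \<and>
          eventually (\<lambda>n. l n \<le> snd (g l) n) (tail (fst (g l))) \<and>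
          (\<forall>u\<in>U. eventually (\<lambda>n. snd (g l) n \<le> u n) (tail (fst (g l))))"
        and g2: "\<And>l m. l \<in> Field q \<Longrightarrow> m \<in> underS q l \<Longrightarrow> fst (g l) \<subseteq>\<^sub>* fst (g m) \<and>
          eventually (\<lambda>n. snd (g m) n \<le> snd (g l) n) (tail (fst (g l)))"
      proof (rule well_order_construct[OF q(3),
            where I = "\<lambda>l x. infinite (fst x) \<and> fst x \<subseteq> A0 \<and>
              eventually (\<lambda>n. l n \<le> snd x n) (tail (fst x)) \<and>
              (\<forall>u\<in>U. eventually (\<lambda>n. snd x n \<le> u n) (tail (fst x)))"
            and R = "\<lambda>m l x z. fst z \<subseteq>\<^sub>* fst x \<and> eventually (\<lambda>n. snd x n \<le> snd z n) (tail (fst z))"])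
        fix l and g :: "(nat \<Rightarrow> nat) \<Rightarrow> nat set \<times> (nat \<Rightarrow> nat)"
        assume l: "l \<in> Field q"
          and g1: "\<forall>m\<in>underS q l. infinite (fst (g m)) \<and> fst (g m) \<subseteq> A0 \<and>
            eventually (\<lambda>n. m n \<le> snd (g m) n) (tail (fst (g m))) \<and>
            (\<forall>u\<in>U. eventually (\<lambda>n. snd (g m) n \<le> u n) (tail (fst (g m))))"
          and g2: "\<forall>m\<in>underS q l. \<forall>k\<in>underS q m. fst (g m) \<subseteq>\<^sub>* fst (g k) \<and>
            eventually (\<lambda>n. snd (g k) n \<le> snd (g m) n) (tail (fst (g m)))"
        obtain A1 where A1: "infinite A1" "A1 \<subseteq> A0" "\<And>m. m \<in> underS q l \<Longrightarrow> A1 \<subseteq>\<^sub>* fst (g m)"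
          by (rule tower_lower_bound_underS[OF q(3) small_q' A0 l, of "\<lambda>m. fst (g m)"]) (use g1 g2 in auto)
        let ?L = "insert l ((\<lambda>m. snd (g m)) ` underS q l)"
        have "|(\<lambda>m. snd (g m)) ` underS q l| <o |L|"
          using card_of_image small_q[OF l] by (rule ordLeq_ordLess_trans)
        with inf have card: "|?L| <o |L|" by (rule card_of_insert_ordLess)
        have "eventually (\<lambda>n. k n \<le> u n) (tail A1)" if k: "k \<in> ?L" and u: "u \<in> U" for k u
        proof (cases "k = l")
          case True
          have "l \<in> L" using l q(2) by simp
          then show ?thesis unfolding True
            using LU[OF _ u] A1(2) eventually_tail_mono subset_imp_almost_subset by blast
        next
          case False
          then obtain m where m: "m \<in> underS q l" "k = snd (g m)" using k by blast
          show ?thesis unfolding m(2)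
            by (rule eventually_tail_mono[OF _ A1(3)[OF m(1)]]) (use g1 m(1) u in blast)
        qed
        from IH[OF card A1(1) this] obtain A' f where A': "infinite A'" "A' \<subseteq> A1"
          "\<forall>k\<in>?L. eventually (\<lambda>n. k n \<le> f n) (tail A')" "\<forall>u\<in>U. eventually (\<lambda>n. f n \<le> u n) (tail A')"
          by blast
        have "A' \<subseteq>\<^sub>* fst (g m)" if "m \<in> underS q l" for m
          using A'(2) A1(3)[OF that] almost_subset_trans subset_imp_almost_subset by blast
        then show "\<exists>x. (infinite (fst x) \<and> fst x \<subseteq> A0 \<and> eventually (\<lambda>n. l n \<le> snd x n) (tail (fst x)) \<and>
            (\<forall>u\<in>U. eventually (\<lambda>n. snd x n \<le> u n) (tail (fst x)))) \<and>
            (\<forall>m\<in>underS q l. fst x \<subseteq>\<^sub>* fst (g m) \<and> eventually (\<lambda>n. snd (g m) n \<le> snd x n) (tail (fst x)))"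
          using A' A1(2) by (intro exI[of _ "(A', f)"]) auto
      qed blast
      define d where "d = (\<lambda>l. snd (g l))"
      have LB: "|Field q| \<le>o |B|" using L unfolding q(2) by (rule ordLess_imp_ordLeq)
      obtain A1 where A1: "infinite A1" "A1 \<subseteq> A0" "\<And>l. l \<in> Field q \<Longrightarrow> A1 \<subseteq>\<^sub>* fst (g l)"
        by (rule tower_lower_bound[OF q(3) order.refl LB A0, of "\<lambda>l. fst (g l)"]) (use g1 g2 in auto)
      have dl: "eventually (\<lambda>n. l n \<le> d l n) (tail A1)" if "l \<in> Field q" for l
        using g1[OF that] A1(3)[OF that] eventually_tail_mono unfolding d_def by blast
      have du: "eventually (\<lambda>n. d l n \<le> u n) (tail A1)" if "l \<in> Field q" "u \<in> U" for l u
        using g1[OF that(1)] that(2) A1(3)[OF that(1)] eventually_tail_mono unfolding d_def by blast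
      have dd: "eventually (\<lambda>n. d m n \<le> d l n) (tail A1)" if "l \<in> Field q" "m \<in> underS q l" for l m
        using g2[OF that] A1(3)[OF that(1)] eventually_tail_mono unfolding d_def by blast
      have dL: "|d ` L| <o |B|" using card_of_image L by (rule ordLeq_ordLess_trans)
      \<comment> \<open>Thinning the upper side: stage \<open>u\<close> goes below \<open>u\<close>
        and all earlier choices but above every \<open>d l\<close>. Both sides have fewer than
        \<open>|B|\<close> members, so \<open>small_fill\<close> suffices.\<close>
      obtain k where k1: "\<And>u. u \<in> Field r \<Longrightarrow> infinite (fst (k u)) \<and> fst (k u) \<subseteq> A1 \<and>
          eventually (\<lambda>n. snd (k u) n \<le> u n) (tail (fst (k u))) \<and>
          (\<forall>l\<in>L. eventually (\<lambda>n. d l n \<le> snd (k u) n) (tail (fst (k u))))"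
        and k2: "\<And>u v. u \<in> Field r \<Longrightarrow> v \<in> underS r u \<Longrightarrow> fst (k u) \<subseteq>\<^sub>* fst (k v) \<and>
          eventually (\<lambda>n. snd (k u) n \<le> snd (k v) n) (tail (fst (k u)))"
      proof (rule well_order_construct[OF r(3),
            where I = "\<lambda>u x. infinite (fst x) \<and> fst x \<subseteq> A1 \<and>
              eventually (\<lambda>n. snd x n \<le> u n) (tail (fst x)) \<and>
              (\<forall>l\<in>L. eventually (\<lambda>n. d l n \<le> snd x n) (tail (fst x)))"
            and R = "\<lambda>v u x z. fst z \<subseteq>\<^sub>* fst x \<and> eventually (\<lambda>n. snd z n \<le> snd x n) (tail (fst z))"])
        fix u and k :: "(nat \<Rightarrow> nat) \<Rightarrow> nat set \<times> (nat \<Rightarrow> nat)"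
        assume u: "u \<in> Field r"
          and k1: "\<forall>v\<in>underS r u. infinite (fst (k v)) \<and> fst (k v) \<subseteq> A1 \<and>
            eventually (\<lambda>n. snd (k v) n \<le> v n) (tail (fst (k v))) \<and>
            (\<forall>l\<in>L. eventually (\<lambda>n. d l n \<le> snd (k v) n) (tail (fst (k v))))"
          and k2: "\<forall>v\<in>underS r u. \<forall>w\<in>underS r v. fst (k v) \<subseteq>\<^sub>* fst (k w) \<and>
            eventually (\<lambda>n. snd (k v) n \<le> snd (k w) n) (tail (fst (k v)))"
        obtain A2 where A2: "infinite A2" "A2 \<subseteq> A1" "\<And>v. v \<in> underS r u \<Longrightarrow> A2 \<subseteq>\<^sub>* fst (k v)"
          by (rule tower_lower_bound_underS[OF r(3) small_r A1(1) u, of "\<lambda>v. fst (k v)"]) (use k1 k2 in auto)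
        let ?U = "insert u ((\<lambda>v. snd (k v)) ` underS r u)"
        have "|(\<lambda>v. snd (k v)) ` underS r u| <o |B|"
          using card_of_image small_r[OF u] by (rule ordLeq_ordLess_trans)
        with \<open>infinite B\<close> have card: "|?U| <o |B|" by (rule card_of_insert_ordLess)
        have le: "eventually (\<lambda>n. x n \<le> w n) (tail A2)" if x: "x \<in> d ` L" and w: "w \<in> ?U" for x w
        proof -
          obtain l where l: "l \<in> L" "x = d l" using x by blast
          show ?thesis
          proof (cases "w = u")
            case True
            have "eventually (\<lambda>n. d l n \<le> u n) (tail A1)" using du[of l u] l(1) u q(2) r(2) by simp
            then show ?thesis unfolding True l(2)
              using A2(2) eventually_tail_mono subset_imp_almost_subset by blast
          next
            case False
            then obtain v where v: "v \<in> underS r u" "w = snd (k v)" using w by blast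
            show ?thesis unfolding v(2) l(2)
              by (rule eventually_tail_mono[OF _ A2(3)[OF v(1)]]) (use k1 v(1) l(1) in blast)
          qed
        qed
        obtain A' f where A': "infinite A'" "A' \<subseteq> A2"
          and f: "\<And>x. x \<in> d ` L \<Longrightarrow> eventually (\<lambda>n. x n \<le> f n) (tail A')"
            "\<And>w. w \<in> ?U \<Longrightarrow> eventually (\<lambda>n. f n \<le> w n) (tail A')"
          by (rule small_fill[OF \<open>infinite B\<close> dL card A2(1) le]) auto
        have "A' \<subseteq>\<^sub>* fst (k v)" if "v \<in> underS r u" for v
          using A'(2) A2(3)[OF that] almost_subset_trans subset_imp_almost_subset by blast
        then show "\<exists>x. (infinite (fst x) \<and> fst x \<subseteq> A1 \<and> eventually (\<lambda>n. snd x n \<le> u n) (tail (fst x)) \<and>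
            (\<forall>l\<in>L. eventually (\<lambda>n. d l n \<le> snd x n) (tail (fst x)))) \<and>
            (\<forall>v\<in>underS r u. fst x \<subseteq>\<^sub>* fst (k v) \<and> eventually (\<lambda>n. snd x n \<le> snd (k v) n) (tail (fst x)))"
          using A' A2(2) f by (intro exI[of _ "(A', f)"]) auto
      qed blast
      define e where "e = (\<lambda>u. snd (k u))"
      have rB: "|Field r| =o |B|" unfolding r(2) by (rule UB)
      have rB': "|Field r| \<le>o |B|" using rB by (rule ordIso_imp_ordLeq)
      obtain A2 where A2: "infinite A2" "A2 \<subseteq> A1" "\<And>u. u \<in> Field r \<Longrightarrow> A2 \<subseteq>\<^sub>* fst (k u)"
        by (rule tower_lower_bound[OF r(3) order.refl rB' A1(1), of "\<lambda>u. fst (k u)"]) (use k1 k2 in auto)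
      have A21: "A2 \<subseteq>\<^sub>* A1" using A2(2) by (rule subset_imp_almost_subset)
      have eu: "eventually (\<lambda>n. e u n \<le> u n) (tail A2)" if "u \<in> Field r" for u
        using k1[OF that] A2(3)[OF that] eventually_tail_mono unfolding e_def by blast
      have de: "eventually (\<lambda>n. d l n \<le> e u n) (tail A2)" if "l \<in> Field q" "u \<in> Field r" for l u
        using k1[OF that(2)] that(1) A2(3)[OF that(2)] eventually_tail_mono unfolding e_def q(2) by blast
      have ee: "eventually (\<lambda>n. e u n \<le> e v n) (tail A2)" if "u \<in> Field r" "v \<in> underS r u" for u v
        using k2[OF that] A2(3)[OF that(1)] eventually_tail_mono unfolding e_def by blast
      have inf_q: "infinite (Field q)" "|Field q| <o |B|" using inf L by (simp_all add: q(2))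
      have dd': "eventually (\<lambda>n. d m n \<le> d l n) (tail A2)" if "l \<in> Field q" "m \<in> underS q l" for l m
        using dd[OF that] A21 by (rule eventually_tail_mono)
      \<comment> \<open>Between the chains the situation is that of \<open>gap_filled\<close>; its
        \<open>f\<close> satisfies \<open>l \<le> d l \<le> f \<le> e u \<le> u\<close> almost
        everywhere.\<close>
      have "\<exists>A' f. infinite A' \<and> A' \<subseteq> A2 \<and> (\<forall>l\<in>Field q. eventually (\<lambda>n. d l n \<le> f n) (tail A')) \<and>
        (\<forall>u\<in>Field r. eventually (\<lambda>n. f n \<le> e u n) (tail A'))"
        by (rule gap_filled[where d = d and e = e, OF q(1) inf_q r(1) rB A2(1) dd' ee de])
      then obtain A' f where A': "infinite A'" "A' \<subseteq> A2"
        and f: "\<forall>l\<in>Field q. eventually (\<lambda>n. d l n \<le> f n) (tail A')"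
          "\<forall>u\<in>Field r. eventually (\<lambda>n. f n \<le> e u n) (tail A')"
        by (elim exE conjE)
      have A'2: "A' \<subseteq>\<^sub>* A2" and A'1: "A' \<subseteq>\<^sub>* A1"
        using A'(2) A2(2) by (auto intro: subset_imp_almost_subset)
      have "eventually (\<lambda>n. l n \<le> f n) (tail A')" if "l \<in> L" for l
      proof -
        have "eventually (\<lambda>n. l n \<le> d l n) (tail A')"
          using eventually_tail_mono[OF dl A'1] that q(2) by simp
        moreover have "eventually (\<lambda>n. d l n \<le> f n) (tail A')" using f(1) that q(2) by simp
        ultimately show ?thesis by eventually_elim auto
      qed
      moreover have "eventually (\<lambda>n. f n \<le> u n) (tail A')" if "u \<in> U" for u
      proof -
        have "eventually (\<lambda>n. e u n \<le> u n) (tail A')"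
          using eventually_tail_mono[OF eu A'2] that r(2) by simp
        moreover have "eventually (\<lambda>n. f n \<le> e u n) (tail A')" using f(2) that r(2) by simp
        ultimately show ?thesis by eventually_elim auto
      qed
      moreover have "A' \<subseteq> A0" using A'(2) A2(2) A1(2) by blast
      ultimately show ?thesis using A'(1) by blast
    qed
  qed
qed

section \<open>The climb through shrinking finite sets\<close>

lemma minimal_sfip_has_pseudo_intersection:
  assumes sfip: "strong_fip B"
  shows "\<exists>X. pseudo_intersection X B"
proof (cases "finite B")
  case True
  then have "infinite (\<Inter>B)" using sfip by (simp add: strong_fip_def)
  then have "pseudo_intersection (\<Inter>B) B"
    by (auto simp: pseudo_intersection_def intro: subset_imp_almost_subset)
  then show ?thesis by blast
next
  case infB: False
  have "|Fpow B| \<le>o |B|" using infB by (rule card_of_Fpow_infinite)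
  have ex_next: "\<exists>x. n \<le> x \<and> x \<in> \<Inter>F" if "F \<in> Fpow B" for F n
  proof -
    have "infinite (\<Inter>F)" using sfip that by (simp add: strong_fip_def Fpow_def)
    then show ?thesis using infinite_nat_iff_unbounded_le by blast
  qed
  obtain g where g: "\<And>F. F \<in> Fpow B \<Longrightarrow>
      eventually (\<lambda>n. (LEAST x. n \<le> x \<and> x \<in> \<Inter>F) \<le> g n) (tail UNIV)"
    by (rule bounded_family[OF \<open>|Fpow B| \<le>o |B|\<close>, of "\<lambda>F n. LEAST x. n \<le> x \<and> x \<in> \<Inter>F"]) auto
  \<comment> \<open>The root is the interval from \<open>n\<close> to \<open>g n\<close>, which
    meets each finite intersection for almost all \<open>n\<close>. Its lower end \<open>n\<close>
    later makes the chosen points unbounded.\<close>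
  define base where "base = (\<lambda>n. [[n..<Suc (g n)]])"
  have base: "eventually (\<lambda>n. set (hd (base n)) \<inter> \<Inter>F \<noteq> {}) (tail A)" if F: "F \<in> Fpow B" for A F
  proof -
    have "eventually (\<lambda>n. (LEAST x. n \<le> x \<and> x \<in> \<Inter>F) \<le> g n) (tail A)"
      using g[OF F] by (rule eventually_tail_mono) (simp add: subset_imp_almost_subset)
    then show ?thesis
    proof (rule eventually_mono)
      fix n assume le: "(LEAST x. n \<le> x \<and> x \<in> \<Inter>F) \<le> g n"
      let ?x = "LEAST x. n \<le> x \<and> x \<in> \<Inter>F"
      have "n \<le> ?x \<and> ?x \<in> \<Inter>F" using ex_next[OF F] by (rule LeastI_ex)
      then have "?x \<in> set (hd (base n)) \<inter> \<Inter>F" using le by (simp add: base_def del: upt_Suc)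
      then show "set (hd (base n)) \<inter> \<Inter>F \<noteq> {}" by blast
    qed
  qed
  define r where "r = card_of B"
  have r: "Card_order r" "Field r = B" "Well_order r"
    unfolding r_def by (rule card_of_Card_order, rule Field_card_of, rule card_of_Well_order)
  have small: "|underS r a| <o |B|" if "a \<in> Field r" for a
    using card_of_underS[OF r(1) that] by (simp add: r_def)
  have le: "|Field r| \<le>o |B|" unfolding r(2) by (rule ordIso_imp_ordLeq[OF card_of_refl])
  define grow where "grow = (\<lambda>n s. shrinking s \<and> prefix (base n) s)"
  have base_nth: "set (s ! 0) = set (hd (base n))" "s \<noteq> []" if "grow n s" for n s
    using that by (auto simp: grow_def base_def prefix_def)
  \<comment> \<open>Stage \<open>a\<close> forces its last set into \<open>a\<close> while
    preserving all finite intersections from \<open>B\<close>.\<close>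
  define I where "I = (\<lambda>a x. infinite (fst x) \<and>
    eventually (\<lambda>n. grow n (snd x n) \<and> set (last (snd x n)) \<subseteq> a) (tail (fst x)) \<and>
    (\<forall>F\<in>Fpow B. eventually (\<lambda>n. set (last (snd x n)) \<inter> \<Inter>F \<noteq> {}) (tail (fst x))))"
  obtain f where f1: "\<And>a. a \<in> Field r \<Longrightarrow> I a (f a)"
    and f2: "\<And>a b. a \<in> Field r \<Longrightarrow> b \<in> underS r a \<Longrightarrow> fst (f a) \<subseteq>\<^sub>* fst (f b) \<and>
      eventually (\<lambda>n. prefix (snd (f b) n) (snd (f a) n)) (tail (fst (f a)))"
  proof (rule well_order_construct[OF r(3), where I = I
        and R = "\<lambda>b a x z. fst z \<subseteq>\<^sub>* fst x \<and> eventually (\<lambda>n. prefix (snd x n) (snd z n)) (tail (fst z))"])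
    fix a and f :: "nat set \<Rightarrow> nat set \<times> (nat \<Rightarrow> nat list list)"
    assume a: "a \<in> Field r" and f1: "\<forall>b\<in>underS r a. I b (f b)"
      and f2: "\<forall>b\<in>underS r a. \<forall>c\<in>underS r b. fst (f b) \<subseteq>\<^sub>* fst (f c) \<and>
        eventually (\<lambda>n. prefix (snd (f c) n) (snd (f b) n)) (tail (fst (f b)))"
    obtain A1 where A1: "infinite A1" "\<And>b. b \<in> underS r a \<Longrightarrow> A1 \<subseteq>\<^sub>* fst (f b)"
      by (rule tower_lower_bound_underS[OF r(3) small infinite_UNIV_nat a, of "\<lambda>b. fst (f b)"])
        (use f1 f2 in \<open>auto simp: I_def\<close>)
    define c where "c = (\<lambda>b. snd (f b))"
    have c_grow: "eventually (\<lambda>n. grow n (c b n)) (tail A1)" if "b \<in> underS r a" for b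
    proof -
      have "eventually (\<lambda>n. grow n (c b n) \<and> set (last (c b n)) \<subseteq> b) (tail (fst (f b)))"
        using f1 that by (simp add: I_def c_def)
      then have "eventually (\<lambda>n. grow n (c b n) \<and> set (last (c b n)) \<subseteq> b) (tail A1)"
        using A1(2)[OF that] by (rule eventually_tail_mono)
      then show ?thesis by (rule eventually_mono) blast
    qed
    have c_meet: "eventually (\<lambda>n. set (last (c b n)) \<inter> \<Inter>F \<noteq> {}) (tail A1)"
      if "b \<in> underS r a" "F \<in> Fpow B" for b F
      by (rule eventually_tail_mono[OF _ A1(2)[OF that(1)]]) (use f1 that in \<open>simp add: I_def c_def\<close>)
    have c_pre: "eventually (\<lambda>n. prefix (c d n) (c b n)) (tail A1)"
      if "b \<in> underS r a" "d \<in> underS r b" for b d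
      by (rule eventually_tail_mono[OF _ A1(2)[OF that(1)]]) (use f2 that in \<open>simp add: c_def\<close>)
    have ex: "eventually (\<lambda>n. \<exists>s. grow n s \<and> (\<forall>b\<in>F. prefix (c b n) s)) (tail A1)"
      if F: "finite F" "F \<subseteq> underS r a" for F
    proof (cases "F = {}")
      case True
      have "grow n (base n)" for n by (simp add: grow_def base_def shrinking_def)
      then have "\<exists>s. grow n s \<and> (\<forall>b\<in>F. prefix (c b n) s)" for n using True by blast
      then show ?thesis by (rule always_eventually[OF allI])
    next
      case False
      have FF: "F \<subseteq> Field r" using F(2) by (auto dest: mem_underS_Field)
      obtain m where m: "m \<in> F" "\<And>b. b \<in> F \<Longrightarrow> b = m \<or> b \<in> underS r m"
        using wo_finite_max[OF r(3) F(1) False FF] by blast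
      have ma: "m \<in> underS r a" using m(1) F(2) by blast
      have "eventually (\<lambda>n. \<forall>b\<in>F. prefix (c b n) (c m n)) (tail A1)"
      proof (intro eventually_ball_finite F(1) ballI)
        fix b assume "b \<in> F"
        then show "eventually (\<lambda>n. prefix (c b n) (c m n)) (tail A1)"
          using m(2)[of b] c_pre[OF ma, of b] by (cases "b = m") auto
      qed
      with c_grow[OF ma] show ?thesis by eventually_elim blast
    qed
    obtain A2 s where A2: "infinite A2" "A2 \<subseteq> A1" and s: "eventually (\<lambda>n. grow n (s n)) (tail A2)"
      and s_pre: "\<And>b. b \<in> underS r a \<Longrightarrow> eventually (\<lambda>n. prefix (c b n) (s n)) (tail A2)"
      using saturation_over[OF small[OF a] A1(1), of grow "\<lambda>b n s. prefix (c b n) s", OF ex] by blast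
    have A21: "A2 \<subseteq>\<^sub>* A1" using A2(2) by (rule subset_imp_almost_subset)
    \<comment> \<open>The last set of \<open>s\<close> may miss some intersections.
      \<open>u F\<close> is the last index at which \<open>s\<close> still meets
      \<open>\<Inter>F\<close>, and \<open>l b\<close> below is the index of the last set of the
      node of \<open>b\<close>, so \<open>l b \<le> u F\<close>.\<close>
    define meet where "meet = (\<lambda>F n. {j. j < length (s n) \<and> set (s n ! j) \<inter> \<Inter>F \<noteq> {}})"
    define u where "u = (\<lambda>F n. Max (meet F n))"
    have fin: "finite (meet F n)" for F n by (simp add: meet_def)
    have meet0: "eventually (\<lambda>n. 0 \<in> meet F n) (tail A2)" if F: "F \<in> Fpow B" for F
      using s base[OF F, of A2]
    proof eventually_elim
      case (elim n)
      then show ?case using base_nth[OF elim(1)] by (simp add: meet_def)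
    qed
    define l where "l = (\<lambda>b n. length (c b n) - 1)"
    have Lcard: "|l ` underS r a| <o |B|" using card_of_image small[OF a] by (rule ordLeq_ordLess_trans)
    have Ucard: "|u ` Fpow B| \<le>o |B|" using card_of_image \<open>|Fpow B| \<le>o |B|\<close> by (rule ordLeq_transitive)
    have lu: "eventually (\<lambda>n. x n \<le> y n) (tail A2)" if x: "x \<in> l ` underS r a" and y: "y \<in> u ` Fpow B" for x y
    proof -
      obtain b F where bF: "b \<in> underS r a" "x = l b" "F \<in> Fpow B" "y = u F" using x y by blast
      show ?thesis
        using s_pre[OF bF(1)] eventually_tail_mono[OF c_grow[OF bF(1)] A21]
          eventually_tail_mono[OF c_meet[OF bF(1,3)] A21]
      proof eventually_elim
        case (elim n)
        have "c b n \<noteq> []" using elim(2) base_nth(2) by blast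
        with prefix_last_nth[OF elim(1) this] elim(3) have "l b n \<in> meet F n"
          by (simp add: meet_def l_def)
        then show ?case using fin unfolding bF u_def by (intro Max_ge)
      qed
    qed
    \<comment> \<open>An index \<open>j\<close> in between keeps all earlier nodes as prefixes and
      still meets every finite intersection.\<close>
    have "\<exists>A' j. infinite A' \<and> A' \<subseteq> A2 \<and> (\<forall>x\<in>l ` underS r a. eventually (\<lambda>n. x n \<le> j n) (tail A')) \<and>
        (\<forall>y\<in>u ` Fpow B. eventually (\<lambda>n. j n \<le> y n) (tail A'))"
      by (rule fill[OF Lcard Ucard A2(1) lu])
    then obtain A' j where A': "infinite A'" "A' \<subseteq> A2"
      and j: "\<forall>x\<in>l ` underS r a. eventually (\<lambda>n. x n \<le> j n) (tail A')"
        "\<forall>y\<in>u ` Fpow B. eventually (\<lambda>n. j n \<le> y n) (tail A')"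
      by (elim exE conjE)
    have jl: "eventually (\<lambda>n. l b n \<le> j n) (tail A')" if "b \<in> underS r a" for b
      using j(1) that by blast
    have ju: "eventually (\<lambda>n. j n \<le> u F n) (tail A')" if "F \<in> Fpow B" for F
      using j(2) that by blast
    have A'2: "A' \<subseteq>\<^sub>* A2" using A'(2) by (rule subset_imp_almost_subset)
    define t where "t = (\<lambda>n. take (Suc (j n)) (s n) @ [filter (\<lambda>x. x \<in> a) (s n ! j n)])"
    have s': "eventually (\<lambda>n. grow n (s n)) (tail A')" using s A'2 by (rule eventually_tail_mono)
    have umeet: "eventually (\<lambda>n. u F n \<in> meet F n) (tail A')" if F: "F \<in> Fpow B" for F
      using eventually_tail_mono[OF meet0[OF F] A'2]
    proof (rule eventually_mono)
      fix n assume "0 \<in> meet F n"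
      then show "u F n \<in> meet F n" using Max_in[OF fin] unfolding u_def by blast
    qed
    have j_len: "eventually (\<lambda>n. j n < length (s n)) (tail A')"
    proof -
      \<comment> \<open>Any \<open>F\<close> would bound \<open>j\<close> by an index of
        \<open>s\<close>; the empty one is always available.\<close>
      have "{} \<in> Fpow B" by (simp add: Fpow_def)
      from umeet[OF this] ju[OF this] show ?thesis by eventually_elim (auto simp: meet_def)
    qed
    have "I a (A', t)"
      unfolding I_def fst_conv snd_conv
    proof (intro conjI ballI)
      show "eventually (\<lambda>n. grow n (t n) \<and> set (last (t n)) \<subseteq> a) (tail A')"
        using s' j_len
      proof eventually_elim
        case (elim n)
        have "shrinking (t n)" unfolding t_def
          using elim by (intro shrinking_snoc) (auto simp: grow_def)
        moreover have "prefix (base n) (take (Suc (j n)) (s n))"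
          using elim(1) by (intro prefix_take) (auto simp: grow_def base_def)
        ultimately show ?case by (auto simp: grow_def t_def)
      qed
      fix F assume F: "F \<in> Fpow B"
      \<comment> \<open>Since \<open>j \<le> u (insert a F)\<close>, the set at \<open>j\<close>
        contains a set meeting \<open>a \<inter> \<Inter>F\<close>, so its part inside
        \<open>a\<close> still meets \<open>\<Inter>F\<close>.\<close>
      then have aF: "insert a F \<in> Fpow B" using a r(2) by (simp add: Fpow_def)
      show "eventually (\<lambda>n. set (last (t n)) \<inter> \<Inter>F \<noteq> {}) (tail A')"
        using s' ju[OF aF] umeet[OF aF]
      proof eventually_elim
        case (elim n)
        have "set (s n ! u (insert a F) n) \<subseteq> set (s n ! j n)"
          using elim by (intro shrinking_antimono) (auto simp: grow_def meet_def)
        then show ?case using elim(3) by (auto simp: meet_def t_def)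
      qed
    qed (rule A'(1))
    moreover have "A' \<subseteq>\<^sub>* fst (f b)" if "b \<in> underS r a" for b
      using almost_subset_trans[OF A'2 almost_subset_trans[OF A21 A1(2)[OF that]]] .
    moreover have "eventually (\<lambda>n. prefix (c b n) (t n)) (tail A')" if b: "b \<in> underS r a" for b
      using eventually_tail_mono[OF s_pre[OF b] A'2] jl[OF b]
    proof eventually_elim
      case (elim n)
      then have "prefix (c b n) (take (Suc (j n)) (s n))" by (intro prefix_take) (auto simp: l_def)
      then show ?case by (simp add: t_def)
    qed
    ultimately show "\<exists>x. I a x \<and> (\<forall>b\<in>underS r a. fst x \<subseteq>\<^sub>* fst (f b) \<and>
        eventually (\<lambda>n. prefix (snd (f b) n) (snd x n)) (tail (fst x)))"
      by (intro exI[of _ "(A', t)"]) (simp add: c_def)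
  qed blast
  \<comment> \<open>Nonemptiness of the last set passes to the upper bound, whose last set then
    supplies the points \<open>x n\<close>. For the nodes themselves it is the case of the empty
    \<open>F\<close>.\<close>
  let ?R = "\<lambda>s t. shrinking t \<and> prefix s t \<and> set (last t) \<noteq> {}"
  have emp: "{} \<in> Fpow B" by (simp add: Fpow_def)
  have ev1: "eventually (\<lambda>n. grow n (snd (f a) n) \<and> set (last (snd (f a) n)) \<subseteq> a) (tail (fst (f a)))"
    and ev2: "eventually (\<lambda>n. set (last (snd (f a) n)) \<inter> \<Inter>{} \<noteq> {}) (tail (fst (f a)))"
    if "a \<in> Field r" for a
    using f1[OF that] emp unfolding I_def by blast+
  obtain A' s where A': "infinite A'" "\<And>a. a \<in> Field r \<Longrightarrow> A' \<subseteq>\<^sub>* fst (f a)"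
    and s: "\<And>a. a \<in> Field r \<Longrightarrow> eventually (\<lambda>n. ?R (snd (f a) n) (s n)) (tail A')"
  proof (rule upper_bound[OF r(3) order.refl le infinite_UNIV_nat, of "\<lambda>a. fst (f a)" ?R "\<lambda>a. snd (f a)"])
    show "transp ?R" by (auto intro!: transpI)
    show "eventually (\<lambda>n. ?R (snd (f a) n) (snd (f a) n)) (tail (fst (f a)))" if a: "a \<in> Field r" for a
      using ev1[OF a] ev2[OF a] by eventually_elim (auto simp: grow_def)
    show "eventually (\<lambda>n. ?R (snd (f b) n) (snd (f a) n)) (tail (fst (f a)))"
      if a: "a \<in> Field r" "b \<in> underS r a" for a b
      using ev1[OF a(1)] ev2[OF a(1)] f2[OF a, THEN conjunct2] by eventually_elim (auto simp: grow_def)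
  qed (use f1 f2 in \<open>auto simp: I_def\<close>)
  define x where "x = (\<lambda>n. SOME x. x \<in> set (last (s n)))"
  \<comment> \<open>The last set of \<open>s n\<close> lies in the last set of the node of
    \<open>a\<close>, hence in \<open>a\<close>, and in the root, hence above
    \<open>n\<close>.\<close>
  have x: "eventually (\<lambda>n. x n \<in> a \<and> n \<le> x n) (tail A')" if a: "a \<in> Field r" for a
    using s[OF a] eventually_tail_mono[OF ev1[OF a] A'(2)[OF a]]
  proof eventually_elim
    case (elim n)
    let ?c = "snd (f a) n"
    have "\<exists>x. x \<in> set (last (s n))" using elim(1) by (simp add: ex_in_conv)
    then have xs: "x n \<in> set (last (s n))" unfolding x_def by (rule someI_ex)
    have ne: "s n \<noteq> []" using elim(1) by (simp add: shrinking_def)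
    have "?c \<noteq> []" using elim(2) base_nth(2) by blast
    with elim(1) have c: "length ?c - 1 < length (s n)" "last ?c = s n ! (length ?c - 1)"
      using prefix_last_nth[of ?c "s n"] by auto
    have "set (last (s n)) \<subseteq> set (last ?c)"
      using shrinking_antimono[of "s n" "length ?c - 1" "length (s n) - 1"] elim(1) c ne
      by (simp add: last_conv_nth)
    moreover have "set (last ?c) \<subseteq> set (?c ! 0)"
      using shrinking_antimono[of ?c 0 "length ?c - 1"] elim(2) \<open>?c \<noteq> []\<close>
      by (simp add: last_conv_nth grow_def)
    moreover have "set (?c ! 0) = {n..<Suc (g n)}"
      using base_nth(1)[of n ?c] elim(2) by (simp add: base_def del: upt_Suc)
    ultimately show ?case using xs elim(2) by auto
  qed
  obtain b where b: "b \<in> B" using infB by (metis ex_in_conv finite.emptyI)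
  let ?X = "x ` A'"
  have "infinite ?X"
  proof
    assume "finite ?X"
    then obtain k where k: "\<And>n. n \<in> A' \<Longrightarrow> x n < k" by (auto simp: finite_nat_set_iff_bounded)
    have "infinite {n \<in> A'. x n \<in> b \<and> n \<le> x n}"
      using eventually_tail_infinite[OF x A'(1)] b r(2) by blast
    moreover have "{n \<in> A'. x n \<in> b \<and> n \<le> x n} \<subseteq> {..<k}" using k by fastforce
    ultimately show False using finite_subset by blast
  qed
  moreover have "?X \<subseteq>\<^sub>* a" if a: "a \<in> B" for a
  proof -
    have "finite (x ` {n \<in> A'. \<not> (x n \<in> a \<and> n \<le> x n)})"
      using x[of a] a r(2) by (simp add: eventually_tail)
    then show ?thesis unfolding almost_subset_def by (rule rev_finite_subset) auto
  qed
  ultimately show ?thesis unfolding pseudo_intersection_def by blast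
qed

end

subsection \<open>The equality\<close>

text \<open>Ensures that p is a minimum over a nonempty class. In a maximal family with the strong
  finite intersection property, half of a pseudo-intersection could be added, so it is a member
  already; yet the other half lies outside it.\<close>

lemma p_family_exists: "\<exists>C. p_family C"
proof -
  let ?S = "{C. strong_fip C}"
  have "\<exists>M\<in>?S. \<forall>X\<in>?S. M \<subseteq> X \<longrightarrow> X = M"
  proof (rule subset_Zorn)
    fix \<C> assume C: "subset.chain ?S \<C>"
    have "strong_fip (\<Union>\<C>)" unfolding strong_fip_def
    proof (intro allI impI)
      fix F assume F: "finite F \<and> F \<subseteq> \<Union>\<C>"
      show "infinite (\<Inter>F)"
      proof (cases "F = {}")
        case False
        then have "\<C> \<noteq> {}" using F by auto
        then obtain D where "D \<in> \<C>" "F \<subseteq> D"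
          using finite_subset_Union_chain[of F \<C> ?S] F C by blast
        then show ?thesis using C F by (auto simp: subset_chain_def strong_fip_def)
      qed simp
    qed
    then show "\<exists>U\<in>?S. \<forall>X\<in>\<C>. X \<subseteq> U" by blast
  qed
  then obtain M where M: "strong_fip M" "\<And>X. strong_fip X \<Longrightarrow> M \<subseteq> X \<Longrightarrow> X = M" by blast
  have "\<nexists>X. pseudo_intersection X M"
  proof
    assume "\<exists>X. pseudo_intersection X M"
    then obtain X where X: "infinite X" "\<And>Z. Z \<in> M \<Longrightarrow> X \<subseteq>\<^sub>* Z" by (auto simp: pseudo_intersection_def)
    obtain Y Z where YZ: "Y \<subseteq> X" "Z \<subseteq> X" "infinite Y" "infinite Z" "Y \<inter> Z = {}"
      using infinite_split[OF X(1)] .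
    have "Z \<subseteq> X - Y" using YZ(2,5) by blast
    with YZ(4) have "infinite (X - Y)" by (metis finite_subset)
    with YZ have Y: "Y \<subseteq> X" "infinite Y" "infinite (X - Y)" by simp_all
    have "strong_fip (insert Y M)" unfolding strong_fip_def
    proof (intro allI impI)
      fix F assume F: "finite F \<and> F \<subseteq> insert Y M"
      have "Y \<subseteq>\<^sub>* Z" if "Z \<in> F" for Z
        using that F X(2)[of Z] Y(1) almost_subset_trans subset_imp_almost_subset by blast
      then have "Y \<subseteq>\<^sub>* \<Inter>F" using F by (intro finite_Inter_almost_subset) auto
      then have "infinite (Y \<inter> \<Inter>F)" using Y(2) by (intro infinite_almost_subset)
      then show "infinite (\<Inter>F)" by (meson finite_Int)
    qed
    then have "Y \<in> M" using M(2)[of "insert Y M"] by blast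
    then have "finite (X - Y)" using X(2) by (simp add: almost_subset_def)
    then show False using Y(3) by simp
  qed
  then show ?thesis using M(1) by (auto simp: p_family_def)
qed

lemma t_tower_card: 
  assumes "t_tower r X"
  shows "p_family (X ` Field r)" "|X ` Field r| \<le>o |Field r|"
  using assms tower_strong_fip by (auto simp: t_tower_def p_family_def card_of_image)

theorem mainTheorem10:
  shows "(frak_p, frak_t) \<in> ordIso"
proof -
  define B where "B = (SOME B. p_family B \<and> (\<forall>B'. p_family B' \<longrightarrow> |B| \<le>o |B'| ))"
  have "\<exists>B. p_family B \<and> (\<forall>B'. p_family B' \<longrightarrow> |B| \<le>o |B'| )"
    using exists_minim_Card_order[of "card_of ` {C. p_family C}"] p_family_exists
    by (auto simp: card_of_Card_order)
  then have B: "p_family B" "\<And>B'. p_family B' \<Longrightarrow> |B| \<le>o |B'|"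
    unfolding B_def by (rule someI2_ex, blast)+
  have p: "frak_p = |B|" by (simp add: frak_p_def B_def)
  have lower: "|B| \<le>o |Field r|" if "t_tower r X" for r X
    using B(2)[OF t_tower_card(1)[OF that]] t_tower_card(2)[OF that] by (rule ordLeq_transitive)
  \<comment> \<open>This gives t \<le> p and also that towers without pseudo-intersection exist,
    which the choice in \<open>frak_t\<close> relies on.\<close>
  have "\<exists>r X. t_tower r X \<and> |Field r| \<le>o |B|"
  proof (rule ccontr)
    assume no: "\<not> ?thesis"
    interpret p_less_t B
    proof
      fix C :: "nat set set" assume C: "|C| <o |B|" "strong_fip C"
      show "\<exists>X. pseudo_intersection X C"
      proof (rule ccontr)
        assume "\<nexists>X. pseudo_intersection X C"
        then have "|B| \<le>o |C|" using C(2) by (intro B(2)) (simp add: p_family_def)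
        then show False using C(1) not_ordLess_ordLeq by blast
      qed
    next
      fix r :: "nat set rel" and X assume "tower r X" "|Field r| \<le>o |B|"
      then show "\<exists>Y. pseudo_intersection Y (X ` Field r)" using no by (auto simp: t_tower_def)
    qed
    show False using minimal_sfip_has_pseudo_intersection B(1) by (auto simp: p_family_def)
  qed
  then obtain r X where rX: "t_tower r X" "|Field r| \<le>o |B|" by blast
  define K where "K = (SOME K. (\<exists>r X. t_tower r X \<and> Field r = K) \<and>
    (\<forall>r' X'. t_tower r' X' \<longrightarrow> |K| \<le>o |Field r'| ))"
  \<comment> \<open>No tower without pseudo-intersection is shorter than \<open>|B|\<close>, so the
    one found is of least length and \<open>K\<close> is well chosen.\<close>
  have "|Field r| \<le>o |Field r'|" if "t_tower r' X'" for r' X'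
    using rX(2) lower[OF that] by (rule ordLeq_transitive)
  then have "\<exists>K. (\<exists>r X. t_tower r X \<and> Field r = K) \<and> (\<forall>r' X'. t_tower r' X' \<longrightarrow> |K| \<le>o |Field r'| )"
    using rX(1) by blast
  then have K: "(\<exists>r X. t_tower r X \<and> Field r = K) \<and> (\<forall>r' X'. t_tower r' X' \<longrightarrow> |K| \<le>o |Field r'| )"
    unfolding K_def by (rule someI_ex)
  have "|K| \<le>o |B|" using K rX ordLeq_transitive by blast
  moreover have "|B| \<le>o |K|" using K lower by blast
  ultimately have "|B| =o |K|" by (simp add: ordIso_iff_ordLeq)
  then show ?thesis by (simp add: p frak_t_def K_def)
qed

end
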